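(* Let $n\ge1$, let $b_1<\dots<b_n$ be a strictly increasing sequence of integers and let $\alpha\le a\le\beta$ be integers with $\alpha\le b_1$ and $b_n\le\beta$. Then $\sum_M u^{\operatorname{inv}(M)}v^{\operatorname{inv}'(M)}$, the sum over all monotone triangles $M$ with $n$ rows, bottom row $(b_1,\dots,b_n)$ and top entry $m_{1,1}=a$, equals the constant term in $x_1,\dots,x_n$ of $$\prod_{i=1}^{n}(1+x_i)^{b_i}x_i^{-n+1}\prod_{1\le i<j\le n}(x_i-x_j)\bigl(1+(1-v)x_i+u(x_j+x_ix_j)\bigr)\cdot\sum_{b=0}^{\beta-\alpha}(-1)^{a+\alpha+b}\binom{b}{a-\alpha}\prod_{i=1}^n(1+x_i)^{-\alpha}\,\langle z^b\rangle\prod_{i=1}^n\frac{1}{1-x_i^{-1}z}.$$ In the special case $u=v=1$ it suffices that $b_1\le\dots\le b_n$ is weakly increasing.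
   Context: A monotone triangle with $n$ rows is a triangular array $M=(m_{i,j})_{1\le j\le i\le n}$ of integers with $m_{i+1,j}\le m_{i,j}\le m_{i+1,j+1}$ for all $1\le j\le i<n$, and each row except possibly the bottom row strictly increasing; its bottom row is $(m_{n,1},\dots,m_{n,n})$ and its top entry is $m_{1,1}$. $\operatorname{inv}(M)=\#\{(i,j):m_{i,j}=m_{i+1,j+1}\}$, $\operatorname{inv}'(M)=\#\{(i,j):m_{i,j}=m_{i+1,j}\}$. $u,v$ are indeterminates. $\langle z^b\rangle$ denotes the coefficient of $z^b$, where $\frac{1}{1-x_i^{-1}z}=\sum_{k\ge0}z^kx_i^{-k}$. Powers $(1+x_i)^{c}$ with negative exponent are expanded as power series in $x_i$ with non-negative exponents. *)

theory Defs
  imports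
    "HOL-Library.Poly_Mapping"
    "HOL-Library.FuncSet"
    "HOL-Computational_Algebra.Polynomial"
    "HOL-Computational_Algebra.Formal_Power_Series"
begin

section \<open>Monotone triangles\<close>

definition triangle_cells :: "nat \<Rightarrow> (nat \<times> nat) set" where
  "triangle_cells n = {(i, j). 1 \<le> j \<and> j \<le> i \<and> i \<le> n}"

text \<open>
  Arrays are extensional on the cells, so that each triangle is represented by exactly one
  function and sums over triangles count each of them once.
\<close>

definition monotone_triangles :: "nat \<Rightarrow> (nat \<times> nat \<Rightarrow> int) set" where
  "monotone_triangles n = {m \<in> extensional (triangle_cells n).
     (\<forall>i j. 1 \<le> j \<and> j \<le> i \<and> i < n \<longrightarrow> m (i + 1, j) \<le> m (i, j) \<and> m (i, j) \<le> m (i + 1, j + 1)) \<and>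
     (\<forall>i j. 1 \<le> j \<and> j < i \<and> i < n \<longrightarrow> m (i, j) < m (i, j + 1))}"

definition mt_inv :: "nat \<Rightarrow> (nat \<times> nat \<Rightarrow> int) \<Rightarrow> nat" where
  "mt_inv n m = card {(i, j). 1 \<le> j \<and> j \<le> i \<and> i < n \<and> m (i, j) = m (i + 1, j + 1)}"

definition mt_inv' :: "nat \<Rightarrow> (nat \<times> nat \<Rightarrow> int) \<Rightarrow> nat" where
  "mt_inv' n m = card {(i, j). 1 \<le> j \<and> j \<le> i \<and> i < n \<and> m (i, j) = m (i + 1, j)}"

definition monotone_triangles_with :: "nat \<Rightarrow> (nat \<Rightarrow> int) \<Rightarrow> int \<Rightarrow> (nat \<times> nat \<Rightarrow> int) set" where
  "monotone_triangles_with n b a =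
     {m \<in> monotone_triangles n. (\<forall>j\<in>{1..n}. m (n, j) = b j) \<and> m (1, 1) = a}"

text \<open>Sums over these sets are sums over finite sets.\<close>

lemma monotone_triangle_bounds:
  assumes m: "m \<in> monotone_triangles n" and "i \<le> n" "1 \<le> j" "j \<le> i"
  shows "m (n, j) \<le> m (i, j) \<and> m (i, j) \<le> m (n, j + (n - i))"
  using assms(2-)
proof (induction i arbitrary: j rule: inc_induct)
  case base
  show ?case by simp
next
  case (step k)
  have 1: "m (k + 1, j) \<le> m (k, j)" "m (k, j) \<le> m (k + 1, j + 1)"
    using m step by (auto simp: monotone_triangles_def)
  have 2: "m (n, j) \<le> m (k + 1, j)" "m (k + 1, j + 1) \<le> m (n, j + 1 + (n - (k + 1)))"
    using step.IH[of j] step.IH[of "j + 1"] step.prems by auto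
  have 3: "j + 1 + (n - (k + 1)) = j + (n - k)" using step.hyps by simp
  show ?case using 1 2(1) 2(2)[unfolded 3] by linarith
qed

lemma finite_monotone_triangles_with: "finite (monotone_triangles_with n b a)"
proof -
  let ?C = "triangle_cells n"
  let ?P = "\<Pi>\<^sub>E p\<in>?C. {b (snd p)..b (snd p + (n - fst p))}"
  have "monotone_triangles_with n b a \<subseteq> ?P"
  proof (intro subsetI PiE_I)
    fix m p assume m: "m \<in> monotone_triangles_with n b a" and p: "p \<in> ?C"
    obtain i j where [simp]: "p = (i, j)" by force
    have ij: "1 \<le> j" "j \<le> i" "i \<le> n" using p by (auto simp: triangle_cells_def)
    have "m (n, j) = b j" "m (n, j + (n - i)) = b (j + (n - i))"
      using m ij unfolding monotone_triangles_with_def by (fastforce, force)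
    then show "m p \<in> {b (snd p)..b (snd p + (n - fst p))}"
      using monotone_triangle_bounds[of m n i j] m ij by (simp add: monotone_triangles_with_def)
  next
    fix m p assume "m \<in> monotone_triangles_with n b a" "p \<notin> ?C"
    then have "m \<in> extensional ?C"
      unfolding monotone_triangles_with_def monotone_triangles_def by blast
    then show "m p = undefined" using \<open>p \<notin> ?C\<close> by (rule extensional_arb)
  qed
  moreover have "finite ?C"
    by (rule finite_subset[of _ "{..n} \<times> {..n}"]) (auto simp: triangle_cells_def)
  then have "finite ?P" by (intro finite_PiE) auto
  ultimately show ?thesis by (rule finite_subset)
qed

section \<open>Formal Laurent series in several variables\<close>

text \<open>
  Variables are indexed by natural numbers and a monomial is a finitely supported integer
  exponent vector. A series involves only finitely many variables, and its exponents are bounded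
  below; this makes the Cauchy product a finite sum in each coefficient. The single number \<open>N\<close>
  in \<open>exps_above\<close> bounds both the variables that occur and the exponents.
\<close>

definition exps_above :: "nat \<Rightarrow> (nat \<Rightarrow>\<^sub>0 int) set" where
  "exps_above N = {e. Poly_Mapping.keys e \<subseteq> {..<N} \<and> (\<forall>i. - int N \<le> Poly_Mapping.lookup e i)}"

typedef (overloaded) 'a mlaurent =
  "{f :: (nat \<Rightarrow>\<^sub>0 int) \<Rightarrow> 'a::zero. \<exists>N. \<forall>e. f e \<noteq> 0 \<longrightarrow> e \<in> exps_above N}"
  morphisms ml_coeff Abs_mlaurent
  by (rule exI[of _ "\<lambda>_. 0"]) simp

setup_lifting type_definition_mlaurent

lemma exps_above_mono: "N \<le> M \<Longrightarrow> exps_above N \<subseteq> exps_above M"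
proof
  fix e assume "N \<le> M" and e: "e \<in> exps_above N"
  have "- int M \<le> Poly_Mapping.lookup e i" for i
  proof -
    have "- int N \<le> Poly_Mapping.lookup e i" using e unfolding exps_above_def by blast
    then show ?thesis using \<open>N \<le> M\<close> by linarith
  qed
  moreover have "Poly_Mapping.keys e \<subseteq> {..<M}"
    using e \<open>N \<le> M\<close> unfolding exps_above_def by fastforce
  ultimately show "e \<in> exps_above M" unfolding exps_above_def by blast
qed

lemma exps_above_add: "d \<in> exps_above N \<Longrightarrow> e \<in> exps_above N \<Longrightarrow> d + e \<in> exps_above (2 * N)"
proof -
  assume a: "d \<in> exps_above N" "e \<in> exps_above N"
  have "Poly_Mapping.keys (d + e) \<subseteq> {..<N}"
    using a keys_add[of d e] unfolding exps_above_def by blast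
  moreover have "- int (2 * N) \<le> Poly_Mapping.lookup (d + e) i" for i
  proof -
    have "- int N \<le> Poly_Mapping.lookup d i" "- int N \<le> Poly_Mapping.lookup e i"
      using a unfolding exps_above_def by blast+
    then show ?thesis by (simp add: lookup_add)
  qed
  moreover have "{..<N} \<subseteq> {..<2 * N}" by auto
  ultimately show ?thesis unfolding exps_above_def by (intro CollectI conjI allI) (rule order_trans)
qed

lemma finite_exps_above_box: "finite {d \<in> exps_above N. e - d \<in> exps_above N}" (is "finite ?D")
proof -
  let ?r = "\<lambda>d. restrict (Poly_Mapping.lookup d) {..<N}"
  have "inj_on ?r ?D"
  proof (rule inj_onI)
    fix c d assume cd: "c \<in> ?D" "d \<in> ?D" "?r c = ?r d"
    show "c = d"
    proof (rule poly_mapping_eqI)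
      fix k show "Poly_Mapping.lookup c k = Poly_Mapping.lookup d k"
      proof (cases "k < N")
        case True
        then show ?thesis using fun_cong[OF cd(3), of k] by simp
      next
        case False
        then have "k \<notin> Poly_Mapping.keys c" "k \<notin> Poly_Mapping.keys d" using cd(1,2) unfolding exps_above_def by blast+
        then show ?thesis by (simp add: in_keys_iff)
      qed
    qed
  qed
  moreover have "?r ` ?D \<subseteq> (\<Pi>\<^sub>E i\<in>{..<N}. {- int N .. Poly_Mapping.lookup e i + int N})"
  proof (intro subsetI, elim imageE)
    fix y d assume y: "y = ?r d" "d \<in> ?D"
    have "- int N \<le> Poly_Mapping.lookup d i \<and> Poly_Mapping.lookup d i \<le> Poly_Mapping.lookup e i + int N" for i
    proof -
      have "- int N \<le> Poly_Mapping.lookup d i" "- int N \<le> Poly_Mapping.lookup (e - d) i"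
        using y(2) unfolding exps_above_def by blast+
      then show ?thesis by (simp add: lookup_minus)
    qed
    then show "y \<in> (\<Pi>\<^sub>E i\<in>{..<N}. {- int N .. Poly_Mapping.lookup e i + int N})"
      unfolding y(1) by (auto intro!: PiE_I)
  qed
  then have "finite (?r ` ?D)" by (rule finite_subset) (intro finite_PiE; simp)
  ultimately show ?thesis using finite_imageD by blast
qed

definition ml_conv ::
  "((nat \<Rightarrow>\<^sub>0 int) \<Rightarrow> 'a) \<Rightarrow> ((nat \<Rightarrow>\<^sub>0 int) \<Rightarrow> 'a) \<Rightarrow> (nat \<Rightarrow>\<^sub>0 int) \<Rightarrow> 'a::comm_ring_1" where
  "ml_conv f g e = (\<Sum>d | f d \<noteq> 0 \<and> g (e - d) \<noteq> 0. f d * g (e - d))"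

lemma ml_conv_eq:
  assumes "\<And>e. f e \<noteq> 0 \<Longrightarrow> e \<in> exps_above N" "\<And>e. g e \<noteq> 0 \<Longrightarrow> e \<in> exps_above N"
  shows "ml_conv f g e = (\<Sum>d \<in> {d \<in> exps_above N. e - d \<in> exps_above N}. f d * g (e - d))"
  unfolding ml_conv_def
  by (rule sum.mono_neutral_left[OF finite_exps_above_box]) (use assms in auto)

lemma ml_conv_support:
  assumes "\<And>e. f e \<noteq> 0 \<Longrightarrow> e \<in> exps_above N" "\<And>e. g e \<noteq> 0 \<Longrightarrow> e \<in> exps_above N"
    and "ml_conv f g e \<noteq> 0"
  shows "e \<in> exps_above (2 * N)"
proof -
  from assms(3) obtain d where "d \<in> {d. f d \<noteq> 0 \<and> g (e - d) \<noteq> 0}"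
    unfolding ml_conv_def by (rule sum.not_neutral_contains_not_neutral)
  then have "f d \<noteq> 0" "g (e - d) \<noteq> 0" by auto
  then have "d + (e - d) \<in> exps_above (2 * N)" by (intro exps_above_add assms(1,2))
  then show ?thesis by simp
qed

lemma ml_common_bound:
  assumes "\<exists>N. \<forall>e. f e \<noteq> 0 \<longrightarrow> e \<in> exps_above N" "\<exists>N. \<forall>e. g e \<noteq> 0 \<longrightarrow> e \<in> exps_above N"
  obtains N where "\<And>e. f e \<noteq> 0 \<Longrightarrow> e \<in> exps_above N" "\<And>e. g e \<noteq> 0 \<Longrightarrow> e \<in> exps_above N"
proof -
  from assms obtain N M where "\<forall>e. f e \<noteq> 0 \<longrightarrow> e \<in> exps_above N" "\<forall>e. g e \<noteq> 0 \<longrightarrow> e \<in> exps_above M"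
    by blast
  moreover have "exps_above N \<subseteq> exps_above (max N M)" "exps_above M \<subseteq> exps_above (max N M)"
    by (simp_all add: exps_above_mono)
  ultimately show ?thesis using that[of "max N M"] by blast
qed

lemma ml_conv_commute: "ml_conv f g e = ml_conv g f e"
  unfolding ml_conv_def
  by (rule sum.reindex_bij_witness[of _ "\<lambda>d. e - d" "\<lambda>d. e - d"]) (auto simp: mult.commute)

lemma ml_conv_add_left:
  assumes "\<exists>N. \<forall>e. f e \<noteq> 0 \<longrightarrow> e \<in> exps_above N" "\<exists>N. \<forall>e. g e \<noteq> 0 \<longrightarrow> e \<in> exps_above N"
    "\<exists>N. \<forall>e. h e \<noteq> 0 \<longrightarrow> e \<in> exps_above N"
  shows "ml_conv (\<lambda>e. f e + g e) h e = ml_conv f h e + ml_conv g h e"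
proof -
  obtain N where N: "\<And>e. f e \<noteq> 0 \<Longrightarrow> e \<in> exps_above N" "\<And>e. g e \<noteq> 0 \<Longrightarrow> e \<in> exps_above N"
    using ml_common_bound[OF assms(1,2)] by blast
  obtain M where M: "\<And>e. h e \<noteq> 0 \<Longrightarrow> e \<in> exps_above M" using assms(3) by blast
  have sub: "exps_above N \<subseteq> exps_above (max N M)" "exps_above M \<subseteq> exps_above (max N M)"
    by (simp_all add: exps_above_mono)
  have f: "\<And>e. f e \<noteq> 0 \<Longrightarrow> e \<in> exps_above (max N M)"
    and g: "\<And>e. g e \<noteq> 0 \<Longrightarrow> e \<in> exps_above (max N M)"
    and h: "\<And>e. h e \<noteq> 0 \<Longrightarrow> e \<in> exps_above (max N M)"
    using N M sub by blast+
  have fg: "\<And>e. f e + g e \<noteq> 0 \<Longrightarrow> e \<in> exps_above (max N M)"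
    using f g by (metis add.right_neutral)
  let ?D = "{d \<in> exps_above (max N M). e - d \<in> exps_above (max N M)}"
  have "ml_conv f h e = (\<Sum>d\<in>?D. f d * h (e - d))" by (rule ml_conv_eq) (erule f, erule h)
  moreover have "ml_conv g h e = (\<Sum>d\<in>?D. g d * h (e - d))" by (rule ml_conv_eq) (erule g, erule h)
  moreover have "ml_conv (\<lambda>e. f e + g e) h e = (\<Sum>d\<in>?D. (f d + g d) * h (e - d))"
    by (rule ml_conv_eq) (erule fg, erule h)
  ultimately show ?thesis by (simp only: distrib_right sum.distrib)
qed

lemma ml_conv_assoc:
  assumes "\<exists>N. \<forall>e. f e \<noteq> 0 \<longrightarrow> e \<in> exps_above N" "\<exists>N. \<forall>e. g e \<noteq> 0 \<longrightarrow> e \<in> exps_above N"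
    "\<exists>N. \<forall>e. h e \<noteq> 0 \<longrightarrow> e \<in> exps_above N"
  shows "ml_conv (ml_conv f g) h e = ml_conv f (ml_conv g h) e"
proof -
  obtain N where N: "\<And>e. f e \<noteq> 0 \<Longrightarrow> e \<in> exps_above N" "\<And>e. g e \<noteq> 0 \<Longrightarrow> e \<in> exps_above N"
    using ml_common_bound[OF assms(1,2)] by blast
  obtain M where M: "\<And>e. h e \<noteq> 0 \<Longrightarrow> e \<in> exps_above M" using assms(3) by blast
  let ?K = "max N M"
  let ?L = "2 * ?K"
  let ?D = "\<lambda>e. {d \<in> exps_above ?L. e - d \<in> exps_above ?L}"
  have sub: "exps_above N \<subseteq> exps_above ?K" "exps_above M \<subseteq> exps_above ?K"
    "exps_above ?K \<subseteq> exps_above ?L"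
    by (rule exps_above_mono; linarith)+
  have fK: "\<And>e. f e \<noteq> 0 \<Longrightarrow> e \<in> exps_above ?K" and gK: "\<And>e. g e \<noteq> 0 \<Longrightarrow> e \<in> exps_above ?K"
    and hK: "\<And>e. h e \<noteq> 0 \<Longrightarrow> e \<in> exps_above ?K"
    using N M sub by blast+
  have f: "\<And>e. f e \<noteq> 0 \<Longrightarrow> e \<in> exps_above ?L" and g: "\<And>e. g e \<noteq> 0 \<Longrightarrow> e \<in> exps_above ?L"
    and h: "\<And>e. h e \<noteq> 0 \<Longrightarrow> e \<in> exps_above ?L"
    using fK gK hK sub by blast+
  have fg: "\<And>e. ml_conv f g e \<noteq> 0 \<Longrightarrow> e \<in> exps_above ?L" using ml_conv_support[OF fK gK] .
  have gh: "\<And>e. ml_conv g h e \<noteq> 0 \<Longrightarrow> e \<in> exps_above ?L" using ml_conv_support[OF gK hK] .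
  have fin: "finite (?D e)" for e by (rule finite_exps_above_box)
  have FG: "ml_conv f g x = (\<Sum>d\<in>?D x. f d * g (x - d))" for x
    by (rule ml_conv_eq) (erule f, erule g)
  have GH: "ml_conv g h x = (\<Sum>d\<in>?D x. g d * h (x - d))" for x
    by (rule ml_conv_eq) (erule g, erule h)
  have FG_H: "ml_conv (ml_conv f g) h x = (\<Sum>d\<in>?D x. ml_conv f g d * h (x - d))" for x
    by (rule ml_conv_eq) (erule fg, erule h)
  have F_GH: "ml_conv f (ml_conv g h) x = (\<Sum>d\<in>?D x. f d * ml_conv g h (x - d))" for x
    by (rule ml_conv_eq) (erule f, erule gh)
  have "ml_conv (ml_conv f g) h e = (\<Sum>d\<in>?D e. (\<Sum>c\<in>?D d. f c * g (d - c)) * h (e - d))"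
    by (simp only: FG_H FG)
  also have "\<dots> = (\<Sum>(d, c)\<in>Sigma (?D e) ?D. f c * g (d - c) * h (e - d))"
    by (subst sum.Sigma[symmetric]) (simp_all add: fin sum_distrib_right)
  also have "\<dots> = (\<Sum>(c, k)\<in>Sigma (?D e) (\<lambda>c. ?D (e - c)). f c * (g k * h (e - c - k)))"
  proof (rule sum.reindex_bij_witness_not_neutral[
        where S' = "{(d, c) \<in> Sigma (?D e) ?D. f c * g (d - c) * h (e - d) = 0}"
          and T' = "{(c, k) \<in> Sigma (?D e) (\<lambda>c. ?D (e - c)). f c * (g k * h (e - c - k)) = 0}"
          and i = "\<lambda>(c, k). (c + k, c)" and j = "\<lambda>(d, c). (c, d - c)"])
    show "finite {(d, c) \<in> Sigma (?D e) ?D. f c * g (d - c) * h (e - d) = 0}"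
      by (rule finite_subset[OF _ finite_SigmaI[OF fin fin]]) auto
    show "finite {(c, k) \<in> Sigma (?D e) (\<lambda>c. ?D (e - c)). f c * (g k * h (e - c - k)) = 0}"
      by (rule finite_subset[OF _ finite_SigmaI[OF fin fin]]) auto
  next
    fix p assume p: "p \<in> Sigma (?D e) ?D - {(d, c) \<in> Sigma (?D e) ?D. f c * g (d - c) * h (e - d) = 0}"
    obtain d c where [simp]: "p = (d, c)" by force
    have nz: "f c * g (d - c) * h (e - d) \<noteq> 0" using p by auto
    then have "f c \<noteq> 0" "g (d - c) \<noteq> 0" "h (e - d) \<noteq> 0" by auto
    then have K: "c \<in> exps_above ?K" "d - c \<in> exps_above ?K" "e - d \<in> exps_above ?K"
      using fK gK hK by blast+
    then have "(d - c) + (e - d) \<in> exps_above ?L" by (intro exps_above_add)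
    then have "e - c \<in> exps_above ?L" by simp
    then show "(case p of (d, c) \<Rightarrow> (c, d - c)) \<in> Sigma (?D e) (\<lambda>c. ?D (e - c)) -
        {(c, k) \<in> Sigma (?D e) (\<lambda>c. ?D (e - c)). f c * (g k * h (e - c - k)) = 0}"
      using K sub nz by (auto simp: mult.assoc)
  next
    fix p assume p: "p \<in> Sigma (?D e) (\<lambda>c. ?D (e - c)) -
        {(c, k) \<in> Sigma (?D e) (\<lambda>c. ?D (e - c)). f c * (g k * h (e - c - k)) = 0}"
    obtain c k where [simp]: "p = (c, k)" by force
    have nz: "f c * (g k * h (e - c - k)) \<noteq> 0" using p by auto
    then have "f c \<noteq> 0" "g k \<noteq> 0" "h (e - c - k) \<noteq> 0" by auto
    then have K: "c \<in> exps_above ?K" "k \<in> exps_above ?K" "e - c - k \<in> exps_above ?K"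
      using fK gK hK by blast+
    then have "c + k \<in> exps_above ?L" by (intro exps_above_add)
    then show "(case p of (c, k) \<Rightarrow> (c + k, c)) \<in> Sigma (?D e) ?D -
        {(d, c) \<in> Sigma (?D e) ?D. f c * g (d - c) * h (e - d) = 0}"
      using K sub nz by (auto simp: mult.assoc diff_diff_eq)
  qed (auto simp: mult.assoc)
  also have "\<dots> = (\<Sum>c\<in>?D e. f c * (\<Sum>k\<in>?D (e - c). g k * h (e - c - k)))"
    by (subst sum.Sigma[symmetric]) (simp_all add: fin sum_distrib_left)
  also have "\<dots> = ml_conv f (ml_conv g h) e"
    by (simp only: F_GH GH)
  finally show ?thesis .
qed

instantiation mlaurent :: (comm_ring_1) comm_ring_1
begin

lift_definition zero_mlaurent :: "'a mlaurent" is "\<lambda>_. 0"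
  by simp

lift_definition one_mlaurent :: "'a mlaurent" is "\<lambda>e. if e = 0 then 1 else 0"
  by (auto simp: exps_above_def)

lift_definition uminus_mlaurent :: "'a mlaurent \<Rightarrow> 'a mlaurent" is "\<lambda>f e. - f e"
  by simp

lift_definition plus_mlaurent :: "'a mlaurent \<Rightarrow> 'a mlaurent \<Rightarrow> 'a mlaurent" is "\<lambda>f g e. f e + g e"
  by (erule (1) ml_common_bound) (metis add.right_neutral)

lift_definition minus_mlaurent :: "'a mlaurent \<Rightarrow> 'a mlaurent \<Rightarrow> 'a mlaurent" is "\<lambda>f g e. f e - g e"
  by (erule (1) ml_common_bound) (metis diff_0_right)

lift_definition times_mlaurent :: "'a mlaurent \<Rightarrow> 'a mlaurent \<Rightarrow> 'a mlaurent" is ml_conv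
  by (erule (1) ml_common_bound) (metis ml_conv_support)

instance
proof
  fix f g h :: "'a mlaurent"
  show "f * g * h = f * (g * h)" by transfer (rule ext, rule ml_conv_assoc)
  show "f * g = g * f" by transfer (rule ext, rule ml_conv_commute)
  show "(f + g) * h = f * h + g * h" by transfer (rule ext, rule ml_conv_add_left)
  show "1 * f = f"
  proof (transfer, rule ext)
    fix f :: "(nat \<Rightarrow>\<^sub>0 int) \<Rightarrow> 'a" and e
    have "ml_conv (\<lambda>e. if e = 0 then 1 else 0) f e = (\<Sum>d\<in>(if f e = 0 then {} else {0}). f (e - d))"
      unfolding ml_conv_def by (rule sum.cong) (auto split: if_splits)
    then show "ml_conv (\<lambda>e. if e = 0 then 1 else 0) f e = f e" by simp
  qed
  show "(0 :: 'a mlaurent) \<noteq> 1" by transfer (metis zero_neq_one)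
qed (transfer; force)+

end

lift_definition ml_const :: "'a \<Rightarrow> 'a::comm_ring_1 mlaurent" is "\<lambda>c e. if e = 0 then c else 0"
  by (auto simp: exps_above_def)

text \<open>The monomial \<open>x\<^sub>i\<^sup>k\<close>, for an arbitrary integer exponent \<open>k\<close>.\<close>

lift_definition ml_var_pow :: "nat \<Rightarrow> int \<Rightarrow> 'a::comm_ring_1 mlaurent"
  is "\<lambda>i k e. if e = Poly_Mapping.single i k then 1 else 0"
  subgoal for i k
    by (rule exI[of _ "max (Suc i) (nat \<bar>k\<bar>)"])
      (auto simp: exps_above_def lookup_single when_def split: if_splits)
  done

abbreviation ml_var :: "nat \<Rightarrow> 'a::comm_ring_1 mlaurent" where
  "ml_var i \<equiv> ml_var_pow i 1"

definition ml_constant_term :: "'a::comm_ring_1 mlaurent \<Rightarrow> 'a" where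
  "ml_constant_term f = ml_coeff f 0"

text \<open>The geometric series \<open>1 - x\<^sub>i + x\<^sub>i\<^sup>2 - \<dots>\<close>, which is the expansion of \<open>(1 + x\<^sub>i)\<^sup>-\<^sup>1\<close>.\<close>

lift_definition ml_inverse_one_plus_var :: "nat \<Rightarrow> 'a::comm_ring_1 mlaurent"
  is "\<lambda>i e. if \<exists>k::nat. e = Poly_Mapping.single i (int k)
            then (- 1) ^ nat (Poly_Mapping.lookup e i) else 0"
  subgoal for i
    by (rule exI[of _ "Suc i"])
      (auto simp: exps_above_def lookup_single when_def split: if_splits)
  done

text \<open>\<open>(1 + x\<^sub>i)\<^sup>c\<close> for an integer \<open>c\<close>, with non-negative powers of \<open>x\<^sub>i\<close> only.\<close>

definition ml_one_plus_var_pow :: "nat \<Rightarrow> int \<Rightarrow> 'a::comm_ring_1 mlaurent" where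
  "ml_one_plus_var_pow i c =
     (if 0 \<le> c then (1 + ml_var i) ^ nat c else ml_inverse_one_plus_var i ^ nat (- c))"

lemma ml_conv_single_left:
  "ml_conv (\<lambda>e. if e = s then 1 else 0) f e = f (e - s)"
proof -
  have "ml_conv (\<lambda>e. if e = s then 1 else 0) f e = (\<Sum>d\<in>(if f (e - s) = 0 then {} else {s}). f (e - d))"
    unfolding ml_conv_def by (rule sum.cong) (auto split: if_splits)
  then show ?thesis by simp
qed

lemma ml_coeff_var_pow_times: "ml_coeff (ml_var_pow i k * f) e = ml_coeff f (e - Poly_Mapping.single i k)"
  by transfer (rule ml_conv_single_left)

lemma one_plus_var_times_inverse: "(1 + ml_var i) * ml_inverse_one_plus_var i = 1"
proof -
  have "ml_coeff ((1 + ml_var i) * ml_inverse_one_plus_var i :: 'a mlaurent) e = ml_coeff 1 e" for e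
  proof -
    let ?s = "Poly_Mapping.single i :: int \<Rightarrow> nat \<Rightarrow>\<^sub>0 int"
    let ?g = "ml_inverse_one_plus_var i :: 'a mlaurent"
    have "ml_coeff ((1 + ml_var i) * ?g) e = ml_coeff ?g e + ml_coeff ?g (e - ?s 1)"
      by (simp add: distrib_right plus_mlaurent.rep_eq ml_coeff_var_pow_times)
    also have "\<dots> = ml_coeff 1 e"
    proof (cases "\<exists>k. e = ?s k")
      case True
      then obtain k where e: "e = ?s k" by blast
      have inj: "?s a = ?s b \<longleftrightarrow> a = b" for a b by (metis lookup_single_eq)
      have d: "e - ?s 1 = ?s (k - 1)" by (simp add: e single_diff)
      have z: "?s k = 0 \<longleftrightarrow> k = 0" by (metis inj single_zero)
      have c: "ml_coeff ?g (?s l) = (if 0 \<le> l then (- 1) ^ nat l else 0)" for l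
        using zero_le_imp_eq_int by (auto simp: ml_inverse_one_plus_var.rep_eq inj)
      show ?thesis
      proof (cases "0 < k")
        case True
        then have "nat k = Suc (nat (k - 1))" by simp
        then show ?thesis using True by (simp add: d c one_mlaurent.rep_eq) (simp add: e c z)
      next
        case False
        then show ?thesis using c[of 0] by (simp add: d c one_mlaurent.rep_eq) (auto simp add: e c z)
      qed
    next
      case False
      have "e - ?s 1 \<noteq> ?s k" for k
      proof
        assume "e - ?s 1 = ?s k"
        then have "e = ?s (k + 1)" by (metis diff_add_cancel single_add)
        then show False using False by blast
      qed
      moreover have "e \<noteq> 0" using False by (metis single_zero)
      ultimately show ?thesis using False
        by (auto simp: ml_inverse_one_plus_var.rep_eq one_mlaurent.rep_eq)
    qed
    finally show ?thesis .
  qed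
  then show ?thesis by (simp add: ml_coeff_inject[symmetric] fun_eq_iff)
qed

section \<open>The two sides of the identity\<close>

text \<open>\<open>1 / (1 - x\<^sub>i\<^sup>-\<^sup>1 z)\<close>, a power series in \<open>z\<close> over the Laurent series in the \<open>x\<^sub>i\<close>.\<close>

definition geometric_z :: "nat \<Rightarrow> 'a::comm_ring_1 mlaurent fps" where
  "geometric_z i = Abs_fps (\<lambda>k. ml_var_pow i (- int k))"

definition mt_gen_fun :: "nat \<Rightarrow> (nat \<Rightarrow> int) \<Rightarrow> int \<Rightarrow> 'a \<Rightarrow> 'a \<Rightarrow> 'a::comm_ring_1" where
  "mt_gen_fun n b a u v = (\<Sum>m\<in>monotone_triangles_with n b a. u ^ mt_inv n m * v ^ mt_inv' n m)"

text \<open>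
  The exponent \<open>a + \<alpha> + k\<close> of the sign may be negative, so the sign is given by its parity.
\<close>

definition mt_series ::
  "nat \<Rightarrow> (nat \<Rightarrow> int) \<Rightarrow> int \<Rightarrow> int \<Rightarrow> int \<Rightarrow> 'a \<Rightarrow> 'a \<Rightarrow> 'a::comm_ring_1 mlaurent" where
  "mt_series n b \<alpha> \<beta> a u v =
     (\<Prod>i=1..n. ml_one_plus_var_pow i (b i) * ml_var_pow i (- int n + 1)) *
     (\<Prod>(i, j)\<in>{(i, j). 1 \<le> i \<and> i < j \<and> j \<le> n}.
        (ml_var i - ml_var j) *
        (1 + (1 - ml_const v) * ml_var i + ml_const u * (ml_var j + ml_var i * ml_var j))) *
     (\<Sum>k=0..nat (\<beta> - \<alpha>).
        (if even (a + \<alpha> + int k) then 1 else - 1) * of_nat (k choose nat (a - \<alpha>)) *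
        (\<Prod>i=1..n. ml_one_plus_var_pow i (- \<alpha>)) *
        fps_nth (\<Prod>i=1..n. geometric_z i) k)"

text \<open>The indeterminates \<open>u\<close> and \<open>v\<close>, as elements of the polynomial ring \<open>\<int>[u][v]\<close>.\<close>

definition indet_u :: "int poly poly" where
  "indet_u = [:[:0, 1:]:]"

definition indet_v :: "int poly poly" where
  "indet_v = [:0, 1:]"

end

theory Submission
  imports Defs "HOL-Combinatorics.Transposition"
begin

text \<open>
  Put \<open>w\<^sub>i = x\<^sub>i\<^sup>-\<^sup>1\<close> and \<open>T(p, q) = 1 + (1 - v) x\<^sub>p + u (x\<^sub>q + x\<^sub>p x\<^sub>q)\<close>, and let \<open>H\<^sub>k(b)\<close> be the constant term of
  \<open>\<Prod>\<^sub>i\<^sub><\<^sub>j (w\<^sub>j - w\<^sub>i) T(i, j) \<cdot> h\<^sub>k(w) \<cdot> \<Prod>\<^sub>i (1 + x\<^sub>i)\<close> to the powers \<open>b\<^sub>i - \<alpha>\<close>, with \<open>h\<^sub>k\<close> the complete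
  symmetric polynomial. Binomial inversion in \<open>k\<close> reduces the theorem to the claim that
  \<open>H\<^sub>k(b)\<close> is the weighted sum of \<open>(m\<^sub>1\<^sub>1 - \<alpha>) choose k\<close> over the triangles with bottom row \<open>b\<close>, which
  is shown by removing the bottom row.

  Summing \<open>H\<^sub>k\<close> over the rows above \<open>b\<close> multiplies the series by geometric sums, with an
  inclusion-exclusion correction that excludes rows with two equal neighbours \<open>l\<^sub>p = l\<^sub>q\<close>. A term in
  which neighbouring variables both carry the same entry of \<open>b\<close> comes with the factor \<open>T(q, p)\<close>;
  since \<open>T(p, q) T(q, p)\<close> is symmetric and the Vandermonde product antisymmetric, its constant
  term is zero. In each remaining term one entry \<open>b\<^sub>j\<close> is not used, and these terms are exactly the
  result of expanding \<open>\<Prod>\<^sub>i\<^sub><\<^sub>j (w\<^sub>j - w\<^sub>i) \<cdot> h\<^sub>k(w)\<close> along a column of ones and putting \<open>x\<^sub>j = 0\<close> in the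
  summand that is free of \<open>w\<^sub>j\<close>.

  For weakly increasing \<open>b\<close> the correction is wrong only at rows with three equal entries. There
  the induction hypothesis for \<open>u = v = 1\<close> gives \<open>H\<^sub>k = 0\<close>, as no triangle has such a bottom row.
\<close>

section \<open>Coefficients and constant terms\<close>

lemma ml_eqI: "(\<And>e. ml_coeff f e = ml_coeff g e) \<Longrightarrow> f = g"
  by (simp add: ml_coeff_inject[symmetric] fun_eq_iff)

lemma ml_coeff_sum: "ml_coeff (sum f A) e = (\<Sum>a\<in>A. ml_coeff (f a) e)"
  by (induction A rule: infinite_finite_induct)
    (simp_all add: zero_mlaurent.rep_eq plus_mlaurent.rep_eq)

lemma ml_coeff_mult_neq_0:
  assumes "ml_coeff (f * g) e \<noteq> 0"
  obtains d where "ml_coeff f d \<noteq> 0" "ml_coeff g (e - d) \<noteq> 0"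
proof -
  have "(\<Sum>d | ml_coeff f d \<noteq> 0 \<and> ml_coeff g (e - d) \<noteq> 0. ml_coeff f d * ml_coeff g (e - d)) \<noteq> 0"
    using assms by (simp add: times_mlaurent.rep_eq ml_conv_def)
  then show ?thesis using that by (metis (mono_tags, lifting) mem_Collect_eq sum.not_neutral_contains_not_neutral)
qed

lemma ml_coeff_const_times: "ml_coeff (ml_const c * f) e = c * ml_coeff f e"
proof -
  \<comment> \<open>The convolution runs only over nonzero products, so its index set is
    \<open>{0}\<close> or empty.\<close>
  have "ml_coeff (ml_const c * f) e =
      (\<Sum>d\<in>(if c = 0 \<or> ml_coeff f e = 0 then {} else {0}). c * ml_coeff f (e - d))"
    unfolding times_mlaurent.rep_eq ml_conv_def ml_const.rep_eq
    by (rule sum.cong) (auto split: if_splits)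
  then show ?thesis by auto
qed

lemma ml_const_0 [simp]: "ml_const 0 = 0"
  and ml_const_1 [simp]: "ml_const 1 = 1"
  and ml_const_add: "ml_const (c + d) = ml_const c + ml_const d"
  and ml_const_diff: "ml_const (c - d) = ml_const c - ml_const d"
  and ml_const_mult: "ml_const (c * d) = ml_const c * ml_const d"
  and ml_const_uminus: "ml_const (- c) = - ml_const c"
  by (rule ml_eqI; simp add: ml_const.rep_eq uminus_mlaurent.rep_eq zero_mlaurent.rep_eq one_mlaurent.rep_eq
      plus_mlaurent.rep_eq minus_mlaurent.rep_eq ml_coeff_const_times)+

lemma of_nat_eq_ml_const: "of_nat m = ml_const (of_nat m)"
  by (induction m) (simp_all add: ml_const_add)

lemma ml_var_pow_0 [simp]: "ml_var_pow i 0 = 1"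
  by (rule ml_eqI) (simp add: ml_var_pow.rep_eq one_mlaurent.rep_eq)

lemma ml_var_pow_mult: "ml_var_pow i k * ml_var_pow i l = ml_var_pow i (k + l)"
proof (rule ml_eqI)
  fix e :: "nat \<Rightarrow>\<^sub>0 int"
  have "e - Poly_Mapping.single i k = Poly_Mapping.single i l \<longleftrightarrow> e = Poly_Mapping.single i (k + l)"
    by (simp add: single_add diff_eq_eq add.commute)
  then show "ml_coeff (ml_var_pow i k * ml_var_pow i l) e = ml_coeff (ml_var_pow i (k + l)) e"
    by (simp add: ml_coeff_var_pow_times ml_var_pow.rep_eq)
qed

lemma ml_var_pow_power: "ml_var_pow i k ^ n = ml_var_pow i (int n * k)"
  by (induction n) (simp_all add: ml_var_pow_mult algebra_simps)

lemma ml_var_inverse: "ml_var_pow i (- 1) * ml_var i = 1" "ml_var i * ml_var_pow i (- 1) = 1"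
  by (simp_all add: ml_var_pow_mult)

lemma ml_constant_term_simps:
  "ml_constant_term 0 = 0"
  "ml_constant_term (f + g) = ml_constant_term f + ml_constant_term g"
  "ml_constant_term (f - g) = ml_constant_term f - ml_constant_term g"
  "ml_constant_term (- f) = - ml_constant_term f"
  "ml_constant_term (ml_const c * f) = c * ml_constant_term f"
  "ml_constant_term (\<Sum>a\<in>A. F a) = (\<Sum>a\<in>A. ml_constant_term (F a))"
  by (simp_all add: ml_constant_term_def zero_mlaurent.rep_eq plus_mlaurent.rep_eq
      minus_mlaurent.rep_eq uminus_mlaurent.rep_eq ml_coeff_const_times ml_coeff_sum)

lemma ml_constant_term_var_pow: "ml_constant_term (ml_var_pow i k) = (if k = 0 then 1 else 0)"
proof -
  have "0 = Poly_Mapping.single i k \<longleftrightarrow> k = 0"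
    by (metis lookup_single_eq lookup_zero single_zero)
  then show ?thesis by (simp add: ml_constant_term_def ml_var_pow.rep_eq)
qed

lemma ml_one_plus_var_pow_0 [simp]: "ml_one_plus_var_pow i 0 = 1"
  by (simp add: ml_one_plus_var_pow_def)

lemma ml_one_plus_var_pow_Suc:
  "ml_one_plus_var_pow i (c + 1) = (1 + ml_var i) * ml_one_plus_var_pow i c"
proof (cases "0 \<le> c")
  case True
  then have "nat (c + 1) = Suc (nat c)" by simp
  then show ?thesis using True by (simp add: ml_one_plus_var_pow_def)
next
  case False
  then have "nat (- c) = Suc (nat (- (c + 1)))" by simp
  then have "(1 + ml_var i) * ml_one_plus_var_pow i c =
      (((1 + ml_var i) * ml_inverse_one_plus_var i) * ml_inverse_one_plus_var i ^ nat (- (c + 1)) :: 'a mlaurent)"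
    using False by (simp add: ml_one_plus_var_pow_def mult.assoc)
  also have "\<dots> = ml_inverse_one_plus_var i ^ nat (- (c + 1))"
    by (simp only: one_plus_var_times_inverse mult_1_left)
  also have "\<dots> = ml_one_plus_var_pow i (c + 1)"
    using False by (cases "c = - 1") (simp_all add: ml_one_plus_var_pow_def)
  finally show ?thesis by simp
qed

text \<open>The geometric series inverts \<open>1 + ml_var i\<close>, so this factor cancels. This
  replaces division in arguments that descend to negative exponents.\<close>

lemma ml_one_plus_var_unit: "(1 + ml_var i) * f = (1 + ml_var i) * g \<longleftrightarrow> f = g"
proof
  assume "(1 + ml_var i) * f = (1 + ml_var i) * g"
  then have "ml_inverse_one_plus_var i * ((1 + ml_var i) * f) =
      ml_inverse_one_plus_var i * ((1 + ml_var i) * g)"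
    by simp
  then show "f = g"
    by (simp only: mult.assoc[symmetric] mult.commute[of "ml_inverse_one_plus_var i"]
        one_plus_var_times_inverse mult_1_left)
qed simp

lemma ml_one_plus_var_pow_add:
  "ml_one_plus_var_pow i (c + d) = ml_one_plus_var_pow i c * ml_one_plus_var_pow i d"
proof (induction d rule: int_induct[where k = 0])
  case (step1 d)
  then show ?case using ml_one_plus_var_pow_Suc[of i "c + d", where 'a = 'a] ml_one_plus_var_pow_Suc[of i d, where 'a = 'a]
    by (simp add: ac_simps)
next
  case (step2 d)
  \<comment> \<open>The downward step is verified after multiplication by the unit
    \<open>1 + ml_var i\<close>, which leads back to the exponent \<open>d\<close>.\<close>
  have "(1 + ml_var i) * ml_one_plus_var_pow i (c + (d - 1)) =
      (1 + ml_var i) * (ml_one_plus_var_pow i c * ml_one_plus_var_pow i (d - 1) :: 'a mlaurent)"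
    using step2 ml_one_plus_var_pow_Suc[of i "c + (d - 1)", where 'a = 'a]
      ml_one_plus_var_pow_Suc[of i "d - 1", where 'a = 'a]
    by (simp add: mult.left_commute)
  then show ?case by (simp only: ml_one_plus_var_unit)
qed simp

section \<open>Setting a variable to zero\<close>

text \<open>A lower bound for the order in the variable \<open>y\<close>. The case
  \<open>r = 0\<close> describes the series in which \<open>y\<close> can be set to zero.\<close>

definition ml_ord_ge :: "nat \<Rightarrow> int \<Rightarrow> 'a::comm_ring_1 mlaurent \<Rightarrow> bool" where
  "ml_ord_ge y r f \<longleftrightarrow> (\<forall>e. ml_coeff f e \<noteq> 0 \<longrightarrow> r \<le> Poly_Mapping.lookup e y)"

lemma ml_ord_ge_add: "ml_ord_ge y r f \<Longrightarrow> ml_ord_ge y r g \<Longrightarrow> ml_ord_ge y r (f + g)"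
  unfolding ml_ord_ge_def by (auto simp: plus_mlaurent.rep_eq) (metis add.left_neutral)

lemma ml_ord_ge_uminus: "ml_ord_ge y r f \<Longrightarrow> ml_ord_ge y r (- f)"
  unfolding ml_ord_ge_def by (simp add: uminus_mlaurent.rep_eq)

lemma ml_ord_ge_diff: "ml_ord_ge y r f \<Longrightarrow> ml_ord_ge y r g \<Longrightarrow> ml_ord_ge y r (f - g)"
  using ml_ord_ge_add[of y r f "- g"] by (simp add: ml_ord_ge_uminus)

lemma ml_ord_ge_0: "ml_ord_ge y r 0"
  by (simp add: ml_ord_ge_def zero_mlaurent.rep_eq)

lemma ml_ord_ge_const: "r \<le> 0 \<Longrightarrow> ml_ord_ge y r (ml_const c)"
  by (simp add: ml_ord_ge_def ml_const.rep_eq)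

lemma ml_ord_ge_1: "r \<le> 0 \<Longrightarrow> ml_ord_ge y r 1"
  using ml_ord_ge_const[of r y 1] by simp

lemma ml_ord_ge_sum: "(\<And>a. a \<in> A \<Longrightarrow> ml_ord_ge y r (F a)) \<Longrightarrow> ml_ord_ge y r (sum F A)"
  by (induction A rule: infinite_finite_induct) (auto intro: ml_ord_ge_0 ml_ord_ge_add)

lemma ml_ord_ge_mult:
  assumes "ml_ord_ge y r f" "ml_ord_ge y s g"
  shows "ml_ord_ge y (r + s) (f * g)"
  unfolding ml_ord_ge_def
proof (intro allI impI)
  fix e assume "ml_coeff (f * g) e \<noteq> 0"
  then obtain d where "ml_coeff f d \<noteq> 0" "ml_coeff g (e - d) \<noteq> 0"
    by (rule ml_coeff_mult_neq_0)
  then have "r \<le> Poly_Mapping.lookup d y" "s \<le> Poly_Mapping.lookup (e - d) y"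
    using assms unfolding ml_ord_ge_def by blast+
  then show "r + s \<le> Poly_Mapping.lookup e y" by (simp add: lookup_minus)
qed

lemma ml_ord_ge_var_pow: "(if i = y then r \<le> k else r \<le> 0) \<Longrightarrow> ml_ord_ge y r (ml_var_pow i k)"
  by (auto simp: ml_ord_ge_def ml_var_pow.rep_eq lookup_single when_def split: if_splits)

lemma ml_ord_ge_inverse_one_plus_var: "ml_ord_ge y 0 (ml_inverse_one_plus_var i)"
  by (auto simp: ml_ord_ge_def ml_inverse_one_plus_var.rep_eq lookup_single when_def split: if_splits)

lemma ml_constant_term_eq_0: "ml_ord_ge y r f \<Longrightarrow> 0 < r \<Longrightarrow> ml_constant_term f = 0"
  by (force simp: ml_ord_ge_def ml_constant_term_def)

text \<open>Congruence modulo the variable \<open>y\<close> among series without negative powers of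
  \<open>y\<close>. It takes the place of a substitution operator and is compatible with products
  and constant terms.\<close>

definition ml_eq_at_0 :: "nat \<Rightarrow> 'a::comm_ring_1 mlaurent \<Rightarrow> 'a mlaurent \<Rightarrow> bool" where
  "ml_eq_at_0 y f g \<longleftrightarrow> ml_ord_ge y 0 f \<and> ml_ord_ge y 0 g \<and> ml_ord_ge y 1 (f - g)"

lemma ml_constant_term_eq_at_0:
  "ml_eq_at_0 y f g \<Longrightarrow> ml_constant_term f = ml_constant_term g"
  using ml_constant_term_eq_0[of y 1 "f - g"]
  by (simp add: ml_eq_at_0_def ml_constant_term_simps)

lemma ml_eq_at_0_refl: "ml_ord_ge y 0 f \<Longrightarrow> ml_eq_at_0 y f f"
  by (simp add: ml_eq_at_0_def ml_ord_ge_0)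

lemma ml_eq_at_0_mult:
  assumes "ml_eq_at_0 y f f'" "ml_eq_at_0 y g g'"
  shows "ml_eq_at_0 y (f * g) (f' * g')"
proof -
  have "f * g - f' * g' = f * (g - g') + (f - f') * g'" by (simp add: algebra_simps)
  moreover have "ml_ord_ge y 1 (f * (g - g') + (f - f') * g')"
    using assms ml_ord_ge_mult[of y 0 f 1 "g - g'"] ml_ord_ge_mult[of y 1 "f - f'" 0 g']
    by (auto simp: ml_eq_at_0_def intro: ml_ord_ge_add)
  ultimately show ?thesis
    using assms ml_ord_ge_mult[of y 0 f 0 g] ml_ord_ge_mult[of y 0 f' 0 g']
    by (simp add: ml_eq_at_0_def)
qed

lemma ml_eq_at_0_prod_list:
  "(\<And>x. x \<in> set xs \<Longrightarrow> ml_eq_at_0 y (F x) (G x)) \<Longrightarrow>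
    ml_eq_at_0 y (\<Prod>x\<leftarrow>xs. F x) (\<Prod>x\<leftarrow>xs. G x)"
  by (induction xs) (auto intro: ml_eq_at_0_mult ml_eq_at_0_refl ml_ord_ge_1)

lemma ml_eq_at_0_one_plus_var_pow: "ml_eq_at_0 y (ml_one_plus_var_pow y c) 1"
proof -
  have pow: "ml_eq_at_0 y f 1 \<Longrightarrow> ml_eq_at_0 y (f ^ n) 1" for f :: "'a mlaurent" and n
    by (induction n) (use ml_eq_at_0_mult[of y f 1] in \<open>fastforce intro: ml_eq_at_0_refl ml_ord_ge_1\<close>)+
  have v: "ml_ord_ge y 1 (ml_var y :: 'a mlaurent)" "ml_ord_ge y 0 (ml_var y :: 'a mlaurent)"
    by (simp_all add: ml_ord_ge_var_pow)
  have "ml_eq_at_0 y (1 + ml_var y :: 'a mlaurent) 1"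
    unfolding ml_eq_at_0_def using v by (auto intro: ml_ord_ge_add ml_ord_ge_1)
  moreover have "ml_eq_at_0 y (ml_inverse_one_plus_var y :: 'a mlaurent) 1"
  proof -
    have "ml_inverse_one_plus_var y - 1 = - (ml_var y * ml_inverse_one_plus_var y :: 'a mlaurent)"
      using one_plus_var_times_inverse[of y, where 'a = 'a] by (simp add: algebra_simps)
    moreover have "ml_ord_ge y 1 (ml_var y * ml_inverse_one_plus_var y :: 'a mlaurent)"
      using ml_ord_ge_mult[OF v(1) ml_ord_ge_inverse_one_plus_var] by simp
    ultimately show ?thesis unfolding ml_eq_at_0_def
      by (simp add: ml_ord_ge_inverse_one_plus_var ml_ord_ge_1 ml_ord_ge_uminus)
  qed
  ultimately show ?thesis unfolding ml_one_plus_var_pow_def by (simp add: pow)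
qed

lemma ml_ord_ge_power: "ml_ord_ge y 0 f \<Longrightarrow> ml_ord_ge y 0 (f ^ n)"
  by (induction n) (use ml_ord_ge_mult[of y 0 f 0] in \<open>auto intro: ml_ord_ge_1\<close>)

lemma ml_ord_ge_one_plus_var_pow: "ml_ord_ge y 0 (ml_one_plus_var_pow i c)"
  by (auto simp: ml_one_plus_var_pow_def
      intro!: ml_ord_ge_power ml_ord_ge_add ml_ord_ge_1 ml_ord_ge_var_pow ml_ord_ge_inverse_one_plus_var)

section \<open>Exchanging two variables\<close>

lift_definition ml_swap :: "nat \<Rightarrow> nat \<Rightarrow> 'a::zero mlaurent \<Rightarrow> 'a mlaurent"
  is "\<lambda>p q f e. f (Poly_Mapping.map_key (transpose p q) e)"
proof -
  fix p q and f :: "(nat \<Rightarrow>\<^sub>0 int) \<Rightarrow> 'a"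
  assume "\<exists>N. \<forall>e. f e \<noteq> 0 \<longrightarrow> e \<in> exps_above N"
  then obtain N where N: "\<And>e. f e \<noteq> 0 \<Longrightarrow> e \<in> exps_above N" by blast
  \<comment> \<open>The bound must exceed \<open>p\<close> and \<open>q\<close>, since the exchange
    may introduce either of these variables.\<close>
  let ?t = "transpose p q" and ?M = "max N (Suc (max p q))"
  have "e \<in> exps_above ?M" if "f (Poly_Mapping.map_key ?t e) \<noteq> 0" for e
  proof -
    have e: "Poly_Mapping.map_key ?t e \<in> exps_above N" using N that .
    have lk: "Poly_Mapping.lookup e i = Poly_Mapping.lookup (Poly_Mapping.map_key ?t e) (?t i)" for i
      by (simp add: map_key.rep_eq)
    have "- int N \<le> Poly_Mapping.lookup e i" for i
      unfolding lk using e by (auto simp: exps_above_def)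
    then have "- int ?M \<le> Poly_Mapping.lookup e i" for i
      by (rule order_trans[rotated]) simp
    moreover have "i < ?M" if "i \<in> Poly_Mapping.keys e" for i
    proof -
      have "?t i \<in> Poly_Mapping.keys (Poly_Mapping.map_key ?t e)"
        using that by (simp add: in_keys_iff lk)
      then have "?t i < N" using e by (auto simp: exps_above_def)
      then show ?thesis by (auto simp: transpose_def split: if_splits)
    qed
    ultimately show ?thesis by (auto simp: exps_above_def)
  qed
  then show "\<exists>N. \<forall>e. f (Poly_Mapping.map_key ?t e) \<noteq> 0 \<longrightarrow> e \<in> exps_above N" by blast
qed

lemma map_key_transpose:
  fixes d e :: "nat \<Rightarrow>\<^sub>0 int"
  shows "Poly_Mapping.map_key (transpose p q) (Poly_Mapping.map_key (transpose p q) e) = e"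
    and "Poly_Mapping.map_key (transpose p q) (d - e) =
      Poly_Mapping.map_key (transpose p q) d - Poly_Mapping.map_key (transpose p q) e"
    and "Poly_Mapping.map_key (transpose p q) e = 0 \<longleftrightarrow> e = 0"
    and "Poly_Mapping.map_key (transpose p q) e = Poly_Mapping.single i k \<longleftrightarrow>
      e = Poly_Mapping.single (transpose p q i) k"
proof -
  let ?m = "Poly_Mapping.map_key (transpose p q) :: (nat \<Rightarrow>\<^sub>0 int) \<Rightarrow> _"
  show inv: "?m (?m e) = e" for e :: "nat \<Rightarrow>\<^sub>0 int"
    by (rule poly_mapping_eqI) (simp add: map_key.rep_eq)
  show "?m (d - e) = ?m d - ?m e"
    by (rule poly_mapping_eqI) (simp add: map_key.rep_eq lookup_minus)
  have "?m 0 = 0" by (rule poly_mapping_eqI) (simp add: map_key.rep_eq)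
  then show "?m e = 0 \<longleftrightarrow> e = 0" by (metis inv)
  have "?m (Poly_Mapping.single i k) = Poly_Mapping.single (transpose p q i) k"
    by (rule poly_mapping_eqI) (auto simp: map_key.rep_eq lookup_single when_def)
  then show "?m e = Poly_Mapping.single i k \<longleftrightarrow> e = Poly_Mapping.single (transpose p q i) k"
    by (metis inv)
qed

lemma ml_swap_mult: "ml_swap p q (f * g) = ml_swap p q f * ml_swap p q g"
  unfolding ml_coeff_inject[symmetric] fun_eq_iff times_mlaurent.rep_eq ml_swap.rep_eq ml_conv_def
  by (intro allI sum.reindex_bij_witness[of _ "Poly_Mapping.map_key (transpose p q)"
        "Poly_Mapping.map_key (transpose p q)"])
    (simp_all add: map_key_transpose)

lemma ml_swap_ring [simp]:
  "ml_swap p q 0 = 0" "ml_swap p q 1 = 1" "ml_swap p q (ml_const c) = ml_const c"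
  "ml_swap p q (f + g) = ml_swap p q f + ml_swap p q g"
  "ml_swap p q (f - g) = ml_swap p q f - ml_swap p q g"
  "ml_swap p q (- f) = - ml_swap p q f"
  "ml_swap p q (f * g) = ml_swap p q f * ml_swap p q g"
  "ml_swap p q (ml_var_pow i k) = ml_var_pow (transpose p q i) k"
  by (simp_all only: ml_swap_mult ml_coeff_inject[symmetric] fun_eq_iff)
    (simp_all add: ml_swap.rep_eq zero_mlaurent.rep_eq one_mlaurent.rep_eq ml_const.rep_eq
      plus_mlaurent.rep_eq minus_mlaurent.rep_eq uminus_mlaurent.rep_eq ml_var_pow.rep_eq
      map_key_transpose)

lemma ml_swap_sum [simp]: "ml_swap p q (sum F A) = (\<Sum>a\<in>A. ml_swap p q (F a))"
  by (induction A rule: infinite_finite_induct) simp_all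

lemma ml_swap_prod_list [simp]: "ml_swap p q (prod_list fs) = (\<Prod>f\<leftarrow>fs. ml_swap p q f)"
  by (induction fs) simp_all

lemma ml_swap_power [simp]: "ml_swap p q (f ^ n) = ml_swap p q f ^ n"
  by (induction n) simp_all

lemma ml_swap_one_plus_var_pow [simp]:
  "ml_swap p q (ml_one_plus_var_pow i c) = ml_one_plus_var_pow (transpose p q i) c"
proof -
  \<comment> \<open>The image of the geometric series is identified as an inverse of
    \<open>1 + ml_var (transpose p q i)\<close>, which is unique by cancellation.\<close>
  have "(1 + ml_var (transpose p q i)) * ml_swap p q (ml_inverse_one_plus_var i) =
      ml_swap p q ((1 + ml_var i) * ml_inverse_one_plus_var i :: 'a mlaurent)"
    by simp
  also have "\<dots> = (1 + ml_var (transpose p q i)) * ml_inverse_one_plus_var (transpose p q i)"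
    by (simp only: one_plus_var_times_inverse ml_swap_ring)
  finally show ?thesis
    by (simp add: ml_one_plus_var_unit ml_one_plus_var_pow_def)
qed

lemma ml_constant_term_swap: "ml_constant_term (ml_swap p q f) = ml_constant_term f"
  using map_key_transpose(3)[of p q 0] by (simp add: ml_constant_term_def ml_swap.rep_eq)

section \<open>An expansion of Vandermonde products\<close>

definition del_nth :: "nat \<Rightarrow> 'b list \<Rightarrow> 'b list" where
  "del_nth j xs = take j xs @ drop (Suc j) xs"

lemma del_nth_simps [simp]:
  "del_nth 0 (x # xs) = xs" "del_nth (Suc j) (x # xs) = x # del_nth j xs"
  by (simp_all add: del_nth_def)

lemma map_del_nth: "map f (del_nth j xs) = del_nth j (map f xs)"
  by (simp add: del_nth_def take_map drop_map)

lemma prod_list_del_nth: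
  fixes f :: "'b \<Rightarrow> 'c::comm_monoid_mult"
  assumes "j < length xs"
  shows "(\<Prod>x\<leftarrow>xs. f x) = f (xs ! j) * (\<Prod>x\<leftarrow>del_nth j xs. f x)"
proof -
  have "xs = take j xs @ xs ! j # drop (Suc j) xs" using assms by (rule id_take_nth_drop)
  then have "(\<Prod>x\<leftarrow>xs. f x) = (\<Prod>x\<leftarrow>take j xs @ xs ! j # drop (Suc j) xs. f x)" by simp
  then show ?thesis by (simp add: del_nth_def mult.left_commute)
qed

text \<open>The order of the list matters because \<open>tfac\<close>, to which this is applied
  later, is not symmetric. Lists make deletion and adjacent exchange of variables explicit.\<close>

primrec pair_prod :: "('b \<Rightarrow> 'b \<Rightarrow> 'c::comm_monoid_mult) \<Rightarrow> 'b list \<Rightarrow> 'c" where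
  "pair_prod f [] = 1"
| "pair_prod f (x # xs) = (\<Prod>y\<leftarrow>xs. f x y) * pair_prod f xs"

primrec vand :: "'b::comm_ring_1 list \<Rightarrow> 'b" where
  "vand [] = 1"
| "vand (x # xs) = (\<Prod>y\<leftarrow>xs. y - x) * vand xs"

text \<open>Expansion of the Vandermonde determinant in the variables \<open>w - t\<close> along its
  column of ones, or Lagrange interpolation of the constant 1 with denominators cleared. The
  induction uses the hypothesis both at \<open>t\<close> and at the first entry \<open>x\<close>, so
  \<open>t\<close> is kept arbitrary.\<close>

lemma vand_expansion:
  assumes "xs \<noteq> []"
  shows "(\<Sum>j<length xs. (- 1) ^ j * (\<Prod>w\<leftarrow>del_nth j xs. w - t) * vand (del_nth j xs)) = vand xs"
  using assms
proof (induction xs arbitrary: t)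
  case (Cons x ys)
  show ?case
  proof (cases "ys = []")
    case False
    define P where "P s = (\<Prod>w\<leftarrow>ys. w - s)" for s
    define D where "D s j = (\<Prod>w\<leftarrow>del_nth j ys. w - s)" for s j
    define V where "V j = vand (del_nth j ys)" for j
    have IH: "(\<Sum>j<length ys. (- 1) ^ j * D s j * V j) = vand ys" for s
      unfolding D_def V_def by (rule Cons.IH[OF False])
    have P: "P s = (ys ! j - s) * D s j" if "j < length ys" for s j
      unfolding P_def D_def using that by (rule prod_list_del_nth)
    \<comment> \<open>A partial fraction identity without denominators: the two cofactors
      \<open>ys ! j - t\<close> and \<open>ys ! j - x\<close> differ by
      \<open>x - t\<close>.\<close>
    have key: "(x - t) * D t j * D x j = P t * D x j - P x * D t j" if "j < length ys" for j
      by (simp add: P[OF that] algebra_simps)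
    have "(\<Sum>j<length (x # ys). (- 1) ^ j * (\<Prod>w\<leftarrow>del_nth j (x # ys). w - t) * vand (del_nth j (x # ys)))
        = P t * vand ys - (\<Sum>j<length ys. (- 1) ^ j * ((x - t) * D t j * D x j) * V j)"
      by (simp add: sum.lessThan_Suc_shift P_def D_def V_def sum_negf mult_ac del: sum.lessThan_Suc)
    also have "(\<Sum>j<length ys. (- 1) ^ j * ((x - t) * D t j * D x j) * V j) =
        (\<Sum>j<length ys. P t * ((- 1) ^ j * D x j * V j) - P x * ((- 1) ^ j * D t j * V j))"
    proof (rule sum.cong)
      fix j assume "j \<in> {..<length ys}"
      then show "(- 1) ^ j * ((x - t) * D t j * D x j) * V j =
          P t * ((- 1) ^ j * D x j * V j) - P x * ((- 1) ^ j * D t j * V j)"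
        by (subst key) (simp_all add: algebra_simps)
    qed simp
    also have "\<dots> = P t * vand ys - P x * vand ys"
      by (simp only: sum_subtractf sum_distrib_left[symmetric] IH)
    finally show ?thesis by (simp add: P_def)
  qed simp
qed simp

text \<open>This is the expansion of a determinant with two columns of ones. By
  \<open>vand_expansion\<close> for the tail at \<open>t = x\<close>, the terms with
  \<open>j > 0\<close> cancel the term \<open>vand ys\<close>.\<close>

lemma vand_alternating_sum:
  assumes "2 \<le> length xs"
  shows "(\<Sum>j<length xs. (- 1) ^ j * vand (del_nth j xs)) = 0"
proof -
  obtain x ys where xs: "xs = x # ys" and "ys \<noteq> []" using assms by (cases xs) fastforce+
  then show ?thesis using vand_expansion[of ys x]
    by (simp add: sum.lessThan_Suc_shift sum_negf mult_ac del: sum.lessThan_Suc)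
qed

lemma vand_swap_adjacent: "vand (as @ q # p # cs) = - vand (as @ p # q # cs)"
  by (induction as) (simp_all add: algebra_simps)

section \<open>Complete symmetric functions of the inverse variables\<close>

definition hsym :: "nat \<Rightarrow> nat list \<Rightarrow> 'a::comm_ring_1 mlaurent" where
  "hsym k xs = fps_nth (\<Prod>x\<leftarrow>xs. geometric_z x) k"

lemma hsym_Nil: "hsym k [] = (if k = 0 then 1 else 0)"
  by (simp add: hsym_def)

lemma hsym_Cons: "hsym k (x # xs) = (\<Sum>i=0..k. ml_var_pow x (- int i) * hsym (k - i) xs)"
  by (simp add: hsym_def fps_mult_nth geometric_z_def)

lemma hsym_swap_adjacent: "hsym k (as @ q # p # cs) = hsym k (as @ p # q # cs)"
  by (simp add: hsym_def mult.left_commute)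

lemma geometric_z_inverse:
  "(1 - fps_const (ml_var_pow x (- 1)) * fps_X) * geometric_z x = (1 :: 'a::comm_ring_1 mlaurent fps)"
proof (rule fps_ext)
  fix k
  show "fps_nth ((1 - fps_const (ml_var_pow x (- 1)) * fps_X) * geometric_z x) k =
      fps_nth (1 :: 'a mlaurent fps) k"
    by (cases k) (simp_all add: left_diff_distrib mult.assoc geometric_z_def ml_var_pow_mult)
qed

text \<open>Multiplying the generating function by 1 - w z, with w the inverse of the deleted
  variable, removes the factor of that variable. At \<open>k = 0\<close> there is no preceding
  coefficient.\<close>

lemma hsym_del_nth:
  assumes "j < length xs"
  shows "hsym k (del_nth j xs) =
    hsym k xs - ml_var_pow (xs ! j) (- 1) * (if k = 0 then 0 else hsym (k - 1) xs)"
proof -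
  let ?G = "\<lambda>xs. (\<Prod>x\<leftarrow>xs. geometric_z x) :: 'a mlaurent fps" and ?W = "ml_var_pow (xs ! j) (- 1)"
  have "?G xs = geometric_z (xs ! j) * ?G (del_nth j xs)"
    using assms by (rule prod_list_del_nth)
  then have "(1 - fps_const ?W * fps_X) * ?G xs = ?G (del_nth j xs)"
    by (simp only: mult.assoc[symmetric] geometric_z_inverse mult_1_left)
  then have "?G (del_nth j xs) = ?G xs - fps_const ?W * (fps_X * ?G xs)"
    by (simp add: algebra_simps)
  then show ?thesis by (simp add: hsym_def)
qed

text \<open>
  With \<open>w\<^sub>i = x\<^sub>i\<^sup>-\<^sup>1\<close> this is the expansion of the determinant \<open>vand w \<cdot> h\<^sub>k w\<close> along the column
  of exponents \<open>0\<close>: the \<open>j\<close>-th summand is free of \<open>w\<^sub>j\<close>.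
\<close>

lemma vand_hsym_expansion:
  assumes "2 \<le> length xs"
  shows "vand (map (\<lambda>x. ml_var_pow x (- 1)) xs) * hsym k xs =
    (\<Sum>j<length xs. (- 1) ^ j * (\<Prod>x\<leftarrow>del_nth j xs. ml_var_pow x (- 1)) *
       (vand (map (\<lambda>x. ml_var_pow x (- 1)) (del_nth j xs)) * hsym k (del_nth j xs)))"
    (is "_ = ?R")
proof -
  define W where "W = (\<lambda>x. ml_var_pow x (- 1) :: 'a mlaurent)"
  define h where "h = (if k = 0 then 0 else hsym (k - 1) xs :: 'a mlaurent)"
  define D where "D j = (\<Prod>x\<leftarrow>del_nth j xs. W x)" for j
  define V where "V j = vand (map W (del_nth j xs))" for j
  have "(\<Prod>x\<leftarrow>xs. W x) = W (xs ! j) * D j" if "j < length xs" for j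
    unfolding D_def using that by (rule prod_list_del_nth)
  \<comment> \<open>The factor \<open>W (xs ! j)\<close> from \<open>hsym_del_nth\<close> completes
    the punctured product \<open>D j\<close> to the full product. The correction is therefore a
    common factor times the alternating sum, which vanishes.\<close>
  then have "?R = (\<Sum>j<length xs. (- 1) ^ j * D j * V j * hsym k xs -
      (\<Prod>x\<leftarrow>xs. W x) * h * ((- 1) ^ j * V j))"
    unfolding W_def[symmetric]
    by (intro sum.cong) (simp_all add: hsym_del_nth D_def V_def h_def W_def algebra_simps)
  also have "\<dots> = (\<Sum>j<length xs. (- 1) ^ j * D j * V j) * hsym k xs -
      (\<Prod>x\<leftarrow>xs. W x) * h * (\<Sum>j<length xs. (- 1) ^ j * V j)"
    by (simp only: sum_subtractf sum_distrib_left sum_distrib_right)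
  also have "(\<Sum>j<length xs. (- 1) ^ j * V j) = 0"
    using vand_alternating_sum[of "map W xs"] assms by (simp add: V_def map_del_nth)
  also have "(\<Sum>j<length xs. (- 1) ^ j * D j * V j) = vand (map W xs)"
  proof -
    have "map W xs \<noteq> []" using assms by auto
    from vand_expansion[OF this, of 0] show ?thesis by (simp add: V_def D_def map_del_nth)
  qed
  finally show ?thesis by (simp add: W_def)
qed

lemma ml_swap_vand [simp]: "ml_swap p q (vand fs) = vand (map (ml_swap p q) fs)"
  by (induction fs) (simp_all add: o_def)

lemma ml_swap_hsym [simp]: "ml_swap p q (hsym k xs) = hsym k (map (transpose p q) xs)"
  by (induction xs arbitrary: k) (simp_all add: hsym_Nil hsym_Cons)

lemma ml_ord_ge_hsym:
  "y \<notin> set xs \<Longrightarrow> ml_ord_ge y 0 (hsym k xs :: 'a::comm_ring_1 mlaurent)"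
proof (induction xs arbitrary: k)
  case (Cons x xs)
  then have "ml_ord_ge y (0 + 0) (ml_var_pow x (- int i) * hsym (k - i) xs :: 'a mlaurent)" for i
    by (intro ml_ord_ge_mult ml_ord_ge_var_pow Cons.IH) auto
  then show ?case by (simp add: hsym_Cons ml_ord_ge_sum)
qed (simp add: hsym_Nil ml_ord_ge_0 ml_ord_ge_1)

lemma ml_ord_ge_mult_0: "ml_ord_ge y 0 f \<Longrightarrow> ml_ord_ge y 0 g \<Longrightarrow> ml_ord_ge y 0 (f * g)"
  using ml_ord_ge_mult[of y 0 f 0 g] by simp

lemma ml_ord_ge_prod_list:
  "(\<And>f. f \<in> set fs \<Longrightarrow> ml_ord_ge y 0 f) \<Longrightarrow> ml_ord_ge y 0 (prod_list fs)"
  by (induction fs) (auto intro: ml_ord_ge_mult_0 ml_ord_ge_1)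

lemma ml_ord_ge_vand:
  "(\<And>f. f \<in> set fs \<Longrightarrow> ml_ord_ge y 0 f) \<Longrightarrow> ml_ord_ge y 0 (vand fs)"
  by (induction fs) (auto intro!: ml_ord_ge_mult_0 ml_ord_ge_prod_list ml_ord_ge_diff ml_ord_ge_1)

text \<open>Makes the names of the variables immaterial, so that the variables left after a deletion
  can be renamed to a fixed list.\<close>

lemma swap_invariant_eq:
  fixes F :: "nat list \<Rightarrow> 'b"
  assumes F: "\<And>p q xs. F (map (transpose p q) xs) = F xs"
    and "distinct xs" "distinct zs" "length xs = length zs"
  shows "F xs = F zs"
proof -
  \<comment> \<open>The lists are aligned from the left. Exchanging the next entries
    \<open>x\<close> and \<open>z\<close> leaves the common prefix \<open>ps\<close> alone because
    neither occurs in it.\<close>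
  have "distinct (ps @ xs) \<Longrightarrow> distinct (ps @ zs) \<Longrightarrow> length xs = length zs \<Longrightarrow>
      F (ps @ xs) = F (ps @ zs)" for ps
  proof (induction "length xs" arbitrary: ps xs zs)
    case (Suc n)
    obtain x xs' where xs: "xs = x # xs'" using Suc.hyps(2) by (cases xs) auto
    obtain z zs' where zs: "zs = z # zs'" using Suc by (cases zs) auto
    let ?t = "transpose x z"
    have "map ?t ps = ps" using Suc.prems xs zs by (intro map_idI) (auto simp: transpose_def)
    then have eq: "map ?t (ps @ xs) = (ps @ [z]) @ map ?t xs'" by (simp add: xs)
    have "distinct (map ?t (ps @ xs))"
      using Suc.prems(1) by (simp only: distinct_map inj_on_transpose)
    then have "F ((ps @ [z]) @ map ?t xs') = F ((ps @ [z]) @ zs')"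
      using Suc.prems Suc.hyps(2) unfolding eq by (intro Suc.hyps(1)) (auto simp: xs zs)
    then show ?case using F[of x z "ps @ xs"] unfolding eq by (simp add: zs)
  qed simp
  from this[of "[]"] show ?thesis using assms by simp
qed

section \<open>The constant term satisfies the recursion over rows\<close>

context
  fixes u v :: "'a::{idom, ring_char_0}" and \<alpha> :: int
begin

definition tfac :: "nat \<Rightarrow> nat \<Rightarrow> 'a mlaurent" where
  "tfac p q = 1 + (1 - ml_const v) * ml_var p + ml_const u * (ml_var q + ml_var p * ml_var q)"

abbreviation tprod :: "nat list \<Rightarrow> 'a mlaurent" where
  "tprod \<equiv> pair_prod tfac"

text \<open>The factor of the series for \<open>H_k\<close> that does not depend on the bottom
  row.\<close>

definition qser :: "nat \<Rightarrow> nat list \<Rightarrow> 'a mlaurent" where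
  "qser k xs = vand (map (\<lambda>x. ml_var_pow x (- 1)) xs) * hsym k xs * tprod xs"

text \<open>The shift by \<open>\<alpha>\<close> absorbs the factors
  \<open>ml_one_plus_var_pow i (- \<alpha>)\<close> of \<open>mt_series\<close>.\<close>

definition ypow :: "nat \<Rightarrow> int \<Rightarrow> 'a mlaurent" where
  "ypow i c = ml_one_plus_var_pow i (c - \<alpha>)"

text \<open>\<open>up1\<close> and \<open>down1\<close> are the contributions of the upper and the
  lower end when one weighted entry is summed over an interval (\<open>sum_entry_coeff\<close>). The
  inverse variable is the denominator of a geometric sum.\<close>

definition up1 :: "nat \<Rightarrow> int \<Rightarrow> 'a mlaurent" where
  "up1 i c = ml_var_pow i (- 1) * (1 + ml_const u * ml_var i) * ypow i c"

definition down1 :: "nat \<Rightarrow> int \<Rightarrow> 'a mlaurent" where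
  "down1 i c = - (ml_var_pow i (- 1) * (1 + (1 - ml_const v) * ml_var i) * ypow i c)"

definition yprod :: "nat list \<Rightarrow> int list \<Rightarrow> 'a mlaurent" where
  "yprod xs bs = (\<Prod>(x, b)\<leftarrow>zip xs bs. ypow x b)"

definition up :: "nat list \<Rightarrow> int list \<Rightarrow> 'a mlaurent" where
  "up xs bs = (\<Prod>(x, b)\<leftarrow>zip xs bs. up1 x b)"

definition down :: "nat list \<Rightarrow> int list \<Rightarrow> 'a mlaurent" where
  "down xs bs = (\<Prod>(x, b)\<leftarrow>zip xs bs. down1 x b)"

lemma zip_prod_simps [simp]:
  "yprod [] bs = 1" "yprod xs [] = 1" "yprod (x # xs) (b # bs) = ypow x b * yprod xs bs"
  "up [] bs = 1" "up xs [] = 1" "up (x # xs) (b # bs) = up1 x b * up xs bs"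
  "down [] bs = 1" "down xs [] = 1" "down (x # xs) (b # bs) = down1 x b * down xs bs"
  by (simp_all add: yprod_def up_def down_def)

lemma ml_swap_factors [simp]:
  "ml_swap p q (tfac i j) = tfac (transpose p q i) (transpose p q j)"
  "ml_swap p q (ypow i c) = ypow (transpose p q i) c"
  by (simp_all add: tfac_def ypow_def)

lemma ml_swap_up1_down1 [simp]:
  "ml_swap p q (up1 i c) = up1 (transpose p q i) c"
  "ml_swap p q (down1 i c) = down1 (transpose p q i) c"
  by (simp_all add: up1_def down1_def)

lemma ml_swap_tprod [simp]: "ml_swap p q (tprod xs) = tprod (map (transpose p q) xs)"
  by (induction xs) (simp_all add: o_def)

lemma ml_swap_qser [simp]: "ml_swap p q (qser k xs) = qser k (map (transpose p q) xs)"
  by (simp add: qser_def o_def)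

lemma ml_swap_zip_prods [simp]:
  "ml_swap p q (up xs bs) = up (map (transpose p q) xs) bs"
  "ml_swap p q (down xs bs) = down (map (transpose p q) xs) bs"
proof (induction xs arbitrary: bs)
  case (Cons x xs)
  { case 1 then show ?case using Cons by (cases bs) simp_all }
  { case 2 then show ?case using Cons by (cases bs) simp_all }
qed simp_all

text \<open>Only the factor of the pair \<open>p\<close>, \<open>q\<close> changes; multiplying
  crosswise avoids a quotient.\<close>

lemma tprod_swap_adjacent:
  "tprod (as @ q # p # cs) * tfac p q = tprod (as @ p # q # cs) * tfac q p"
proof (induction as)
  case (Cons a as)
  have "(\<Prod>y\<leftarrow>as @ q # p # cs. tfac a y) = (\<Prod>y\<leftarrow>as @ p # q # cs. tfac a y)"
    by (simp add: mult.left_commute)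
  then show ?case by (simp only: append_Cons pair_prod.simps mult.assoc Cons)
qed (simp add: mult_ac)

lemma tprod_insert:
  "tprod (as @ y # cs) = tprod (as @ cs) * ((\<Prod>a\<leftarrow>as. tfac a y) * (\<Prod>c\<leftarrow>cs. tfac y c))"
  by (induction as) (simp_all add: mult_ac)

text \<open>The extra \<open>tfac q p\<close> turns the one asymmetric factor
  \<open>tfac p q\<close> into a symmetric product, so that only the sign of \<open>vand\<close> is
  left.\<close>

lemma qser_antisymmetric:
  assumes "distinct (as @ p # q # cs)"
  shows "ml_swap p q (qser k (as @ p # q # cs) * tfac q p) = - (qser k (as @ p # q # cs) * tfac q p)"
proof -
  have "transpose p q x = x" if "x \<in> set as \<union> set cs" for x
    using assms that by (auto simp: transpose_def)
  then have "ml_swap p q (qser k (as @ p # q # cs) * tfac q p) =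
      vand (map (\<lambda>x. ml_var_pow x (- 1)) (as @ q # p # cs)) * hsym k (as @ q # p # cs) *
      (tprod (as @ q # p # cs) * tfac p q)"
    by (simp add: qser_def o_def mult_ac cong: map_cong)
  moreover have "vand (map (\<lambda>x. ml_var_pow x (- 1)) (as @ q # p # cs)) =
      - vand (map (\<lambda>x. ml_var_pow x (- 1) :: 'a mlaurent) (as @ p # q # cs))"
    unfolding map_append list.map by (rule vand_swap_adjacent)
  ultimately show ?thesis
    by (simp only: tprod_swap_adjacent[of as q p] hsym_swap_adjacent[of k as q p] qser_def
        mult_minus_left mult.assoc)
qed

text \<open>
  The terms of \<open>\<Prod>\<^sub>i (down1 x\<^sub>i b\<^sub>i + up1 x\<^sub>i b\<^sub>i\<^sub>+\<^sub>1)\<close> in which no entry of \<open>b\<close> occurs twice, that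
  is, in which no \<open>up1\<close> is followed by a \<open>down1\<close>.
\<close>

definition lser :: "nat list \<Rightarrow> int list \<Rightarrow> 'a mlaurent" where
  "lser xs bs = (\<Sum>j\<le>length xs. down (take j xs) (take j bs) * up (drop j xs) (drop (Suc j) bs))"

lemma lser_Nil [simp]: "lser [] bs = 1"
  by (simp add: lser_def)

lemma lser_Cons: "lser (x # xs) (b # bs) = up (x # xs) bs + down1 x b * lser xs bs"
  by (simp add: lser_def sum.atMost_Suc_shift sum_distrib_left mult.assoc del: sum.atMost_Suc)

lemma ml_swap_lser [simp]: "ml_swap p q (lser xs bs) = lser (map (transpose p q) xs) bs"
  by (simp add: lser_def take_map drop_map)

text \<open>
  The same product, corrected by \<open>- u v\<close> for pairs of neighbouring variables that both take the
  entry of \<open>b\<close> between them.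
\<close>

fun rser :: "nat list \<Rightarrow> int list \<Rightarrow> 'a mlaurent" where
  "rser (x # z # xs) (b # c # bs) = (up1 x c + down1 x b) * rser (z # xs) (c # bs) -
     ml_const (u * v) * (ypow x c * ypow z c) * rser xs bs"
| "rser [x] (b # c # bs) = up1 x c + down1 x b"
| "rser _ _ = 1"

lemma antisymmetric_constant_term:
  assumes "ml_swap p q f = - f" "ml_swap p q g = g"
  shows "ml_constant_term (f * g :: 'a mlaurent) = 0"
proof -
  have "ml_constant_term (f * g) = ml_constant_term (ml_swap p q (f * g))"
    by (simp only: ml_constant_term_swap)
  also have "\<dots> = - ml_constant_term (f * g)"
    using assms by (simp add: ml_constant_term_simps)
  \<comment> \<open>An element equal to its own negative is zero, because 2 can be cancelled in the
    coefficient ring.\<close>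
  finally show ?thesis by (metis eq_neg_iff_add_eq_0 mult_2 mult_eq_0_iff zero_neq_numeral)
qed

text \<open>When neighbours both carry the entry between them, their term and the correction in
  \<open>rser\<close> combine to a multiple of \<open>tfac q p\<close>, whose constant term vanishes
  by antisymmetry. The factor \<open>r\<close> collects what the induction has split off; it must be
  symmetric in the variables still to be treated.\<close>

lemma constant_term_rser:
  assumes "length bs = Suc (length xs)" "distinct xs"
    and "\<And>as p q cs. xs = as @ p # q # cs \<Longrightarrow> ml_swap p q (f * tfac q p) = - (f * tfac q p)"
    and "\<And>p q. p \<in> set xs \<Longrightarrow> q \<in> set xs \<Longrightarrow> ml_swap p q r = r"
  shows "ml_constant_term (f * (r * rser xs bs)) = ml_constant_term (f * (r * lser xs bs))"
  using assms
proof (induction xs bs arbitrary: r rule: rser.induct)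
  case (1 x z xs b c bs)
  let ?y = "ypow x c * ypow z c"
  have 1: "ml_constant_term (f * (r * (up1 x c + down1 x b) * rser (z # xs) (c # bs))) =
      ml_constant_term (f * (r * (up1 x c + down1 x b) * lser (z # xs) (c # bs)))"
  proof (rule "1.IH"(1))
    fix as p q cs assume "z # xs = as @ p # q # cs"
    then show "ml_swap p q (f * tfac q p) = - (f * tfac q p)"
      using "1.prems"(3)[of "x # as" p q cs] by simp
  next
    fix p q assume pq: "p \<in> set (z # xs)" "q \<in> set (z # xs)"
    then have "transpose p q x = x" using "1.prems"(2) by (auto simp: transpose_def)
    then show "ml_swap p q (r * (up1 x c + down1 x b)) = r * (up1 x c + down1 x b)"
      using "1.prems"(4) pq by simp
  qed (use "1.prems" in auto)
  have 2: "ml_constant_term (f * (r * (ml_const (u * v) * ?y) * rser xs bs)) =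
      ml_constant_term (f * (r * (ml_const (u * v) * ?y) * lser xs bs))"
  proof (rule "1.IH"(2))
    fix as p q cs assume "xs = as @ p # q # cs"
    then show "ml_swap p q (f * tfac q p) = - (f * tfac q p)"
      using "1.prems"(3)[of "x # z # as" p q cs] by simp
  next
    fix p q assume pq: "p \<in> set xs" "q \<in> set xs"
    then have "transpose p q x = x" "transpose p q z = z"
      using "1.prems"(2) by (auto simp: transpose_def)
    then show "ml_swap p q (r * (ml_const (u * v) * ?y)) = r * (ml_const (u * v) * ?y)"
      using "1.prems"(4) pq by simp
  qed (use "1.prems" in auto)
  have 3: "ml_constant_term (f * tfac z x *
      (r * (ml_var_pow x (- 1) * ml_var_pow z (- 1) * ?y * lser xs bs))) = 0"
  proof (rule antisymmetric_constant_term[of x z])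
    show "ml_swap x z (f * tfac z x) = - (f * tfac z x)" using "1.prems"(3)[of "[]" x z xs] by simp
    have "map (transpose x z) xs = xs"
      using "1.prems"(2) by (auto intro!: map_idI simp: transpose_def)
    then show "ml_swap x z (r * (ml_var_pow x (- 1) * ml_var_pow z (- 1) * ?y * lser xs bs)) =
        r * (ml_var_pow x (- 1) * ml_var_pow z (- 1) * ?y * lser xs bs)"
      using "1.prems"(4) by (simp add: mult_ac)
  qed
  \<comment> \<open>Writing 1 as a variable times its inverse gives the correction the same monomial
    factor as the product. What remains is (1 + u x)(1 + (1 - v) z) + u v x z = T(z, x).\<close>
  have pair: "up1 x c * down1 z c - ml_const (u * v) * ?y =
      - (tfac z x * (ml_var_pow x (- 1) * ml_var_pow z (- 1) * ?y))"
  proof -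
    let ?U = "ml_const u" and ?V = "ml_const v" and ?X = "ml_var x" and ?Z = "ml_var z"
      and ?R = "ml_var_pow x (- 1) :: 'a mlaurent" and ?S = "ml_var_pow z (- 1) :: 'a mlaurent"
    have 1: "ml_const (u * v) * ?y = ?U * ?V * (?R * ?X) * (?S * ?Z) * ?y"
      by (simp add: ml_const_mult ml_var_inverse)
    have 2: "(r * (1 + U * X) * y) * (- (s * (1 + (1 - V) * Z) * t)) - U * V * (r * X) * (s * Z) * (y * t) =
        - ((1 + (1 - V) * Z + U * (X + Z * X)) * (r * s * (y * t)))"
      for r s t y U V X Z :: "'a mlaurent"
      by (simp add: algebra_simps)
    show ?thesis unfolding 1 up1_def down1_def tfac_def by (rule 2)
  qed
  \<comment> \<open>\<open>L\<close> is split by whether \<open>z\<close> takes its upper or lower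
    term. Only \<open>a * e\<close>, that is \<open>up1 x c * down1 z c\<close>, yields no term of
    the longer \<open>lser\<close>; together with the correction \<open>k\<close> it leaves
    \<open>- t\<close>.\<close>
  have regroup: "(a + d) * L - k * L' = L'' - t * L'"
    if "L = w + e * L'" "L'' = a * w + d * L" "a * e - k = - t" for a d e k t w L L' L'' :: "'a mlaurent"
  proof -
    have "k = a * e + t" using that(3) by (simp add: algebra_simps)
    then show ?thesis unfolding that(1,2) by (simp add: algebra_simps)
  qed
  have "(up1 x c + down1 x b) * lser (z # xs) (c # bs) - ml_const (u * v) * ?y * lser xs bs =
      lser (x # z # xs) (b # c # bs) - tfac z x * (ml_var_pow x (- 1) * ml_var_pow z (- 1) * ?y) * lser xs bs"
    by (rule regroup[OF lser_Cons _ pair]) (simp add: lser_Cons[of x])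
  then have "f * (r * ((up1 x c + down1 x b) * lser (z # xs) (c # bs) - ml_const (u * v) * ?y * lser xs bs)) =
      f * (r * (lser (x # z # xs) (b # c # bs) - tfac z x * (ml_var_pow x (- 1) * ml_var_pow z (- 1) * ?y) * lser xs bs))"
    by simp
  then have "f * (r * ((up1 x c + down1 x b) * lser (z # xs) (c # bs))) - f * (r * (ml_const (u * v) * ?y * lser xs bs)) =
      f * (r * lser (x # z # xs) (b # c # bs)) - f * tfac z x *
      (r * (ml_var_pow x (- 1) * ml_var_pow z (- 1) * ?y * lser xs bs))"
    by (simp only: right_diff_distrib mult_ac)
  from arg_cong[OF this, of ml_constant_term]
  have "ml_constant_term (f * (r * ((up1 x c + down1 x b) * lser (z # xs) (c # bs)))) -
      ml_constant_term (f * (r * (ml_const (u * v) * ?y * lser xs bs))) =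
      ml_constant_term (f * (r * lser (x # z # xs) (b # c # bs)))"
    by (simp only: ml_constant_term_simps 3 diff_0_right)
  then show ?case using 1 2
    by (simp only: rser.simps right_diff_distrib ml_constant_term_simps mult.assoc)
next
  case (2 x b c bs)
  then show ?case by (simp add: lser_Cons)
qed simp_all

definition hser :: "nat \<Rightarrow> nat list \<Rightarrow> int list \<Rightarrow> 'a" where
  "hser k xs bs = ml_constant_term (qser k xs * yprod xs bs)"

text \<open>The two values are the factors occurring in \<open>down1\<close> and \<open>up1\<close>:
  variables before \<open>y\<close> become lower terms, variables after it upper terms.\<close>

lemma tfac_at_0:
  assumes "i \<noteq> y"
  shows "ml_eq_at_0 y (tfac i y) (1 + (1 - ml_const v) * ml_var i)"
    and "ml_eq_at_0 y (tfac y i) (1 + ml_const u * ml_var i)"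
proof -
  have o: "ml_ord_ge y 0 (ml_var i)" "ml_ord_ge y 0 (ml_var y)" "ml_ord_ge y 1 (ml_var y)"
    using assms by (auto intro!: ml_ord_ge_var_pow)
  note i = ml_ord_ge_add ml_ord_ge_diff ml_ord_ge_mult_0 ml_ord_ge_const ml_ord_ge_1 o
  have d: "tfac i y - (1 + (1 - ml_const v) * ml_var i) = (ml_const u * (1 + ml_var i)) * ml_var y"
    "tfac y i - (1 + ml_const u * ml_var i) = (1 - ml_const v + ml_const u * ml_var i) * ml_var y"
    by (simp_all add: tfac_def algebra_simps)
  have "ml_ord_ge y (0 + 1) ((ml_const u * (1 + ml_var i)) * ml_var y)"
    "ml_ord_ge y (0 + 1) ((1 - ml_const v + ml_const u * ml_var i) * ml_var y)"
    by (rule ml_ord_ge_mult; intro i; simp)+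
  then show "ml_eq_at_0 y (tfac i y) (1 + (1 - ml_const v) * ml_var i)"
    "ml_eq_at_0 y (tfac y i) (1 + ml_const u * ml_var i)"
    unfolding ml_eq_at_0_def d by (simp_all add: tfac_def i)
qed

lemma yprod_append:
  "length as = length bs \<Longrightarrow> yprod (as @ cs) (bs @ ds) = yprod as bs * yprod cs ds"
  by (simp add: yprod_def)

lemma up_down_eq:
  assumes "length xs = length bs"
  shows "up xs bs = (\<Prod>x\<leftarrow>xs. ml_var_pow x (- 1)) * (\<Prod>x\<leftarrow>xs. 1 + ml_const u * ml_var x) * yprod xs bs"
    and "down xs bs = (- 1) ^ length xs * (\<Prod>x\<leftarrow>xs. ml_var_pow x (- 1)) *
      (\<Prod>x\<leftarrow>xs. 1 + (1 - ml_const v) * ml_var x) * yprod xs bs"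
  using assms
  by (induction xs bs rule: list_induct2) (simp_all add: up1_def down1_def mult_ac)

lemma ml_ord_ge_tprod: "ml_ord_ge y 0 (tprod xs)"
proof -
  have "ml_ord_ge y 0 (tfac i j)" for i j
    unfolding tfac_def
    by (intro ml_ord_ge_add ml_ord_ge_diff ml_ord_ge_mult_0 ml_ord_ge_const ml_ord_ge_1
        ml_ord_ge_var_pow) auto
  then show ?thesis
    by (induction xs) (auto intro!: ml_ord_ge_mult_0 ml_ord_ge_prod_list ml_ord_ge_1)
qed

lemma ml_ord_ge_yprod: "ml_ord_ge y 0 (yprod xs bs)"
  by (auto simp: yprod_def ypow_def intro!: ml_ord_ge_prod_list ml_ord_ge_one_plus_var_pow)

text \<open>The variable \<open>y\<close> occurs only in \<open>tfac\<close> factors and in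
  \<open>ypow y b\<close>, without negative powers, so it may be set to zero. Then \<open>b\<close>
  disappears, and the sign of the expansion is the one carried by \<open>down\<close>.\<close>

lemma constant_term_insert:
  assumes "distinct (as @ y # cs)" "length as = length bs" "length cs = length ds"
  shows "ml_constant_term ((- 1) ^ length as * (\<Prod>x\<leftarrow>as @ cs. ml_var_pow x (- 1)) *
      (vand (map (\<lambda>x. ml_var_pow x (- 1)) (as @ cs)) * hsym k (as @ cs)) *
      (tprod (as @ y # cs) * yprod (as @ y # cs) (bs @ b # ds))) =
    ml_constant_term (qser k (as @ cs) * (down as bs * up cs ds))"
proof -
  let ?W = "\<lambda>x. ml_var_pow x (- 1) :: 'a mlaurent"
  let ?A = "\<Prod>x\<leftarrow>as. 1 + (1 - ml_const v) * ml_var x" and ?B = "\<Prod>x\<leftarrow>cs. 1 + ml_const u * ml_var x"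
  let ?C = "(- 1) ^ length as * (\<Prod>x\<leftarrow>as @ cs. ?W x) * (vand (map ?W (as @ cs)) * hsym k (as @ cs))"
  have y: "y \<notin> set (as @ cs)" using assms(1) by auto
  have W: "x \<in> set (as @ cs) \<Longrightarrow> ml_ord_ge y 0 (?W x)" for x
    using y by (intro ml_ord_ge_var_pow) auto
  have "ml_ord_ge y 0 ((- 1 :: 'a mlaurent) ^ length as)"
    by (intro ml_ord_ge_power ml_ord_ge_uminus ml_ord_ge_1) simp
  moreover have "ml_ord_ge y 0 (\<Prod>x\<leftarrow>as @ cs. ?W x)" "ml_ord_ge y 0 (vand (map ?W (as @ cs)))"
    using W by (fastforce intro: ml_ord_ge_prod_list ml_ord_ge_vand simp del: map_append)+
  ultimately have C: "ml_ord_ge y 0 ?C"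
    by (intro ml_ord_ge_mult_0 ml_ord_ge_hsym y)
  have A: "ml_eq_at_0 y (\<Prod>a\<leftarrow>as. tfac a y) ?A" and B: "ml_eq_at_0 y (\<Prod>c\<leftarrow>cs. tfac y c) ?B"
    using y by (auto intro!: ml_eq_at_0_prod_list tfac_at_0)
  have P: "ml_eq_at_0 y (ypow y b * (yprod as bs * yprod cs ds)) (1 * (yprod as bs * yprod cs ds))"
    unfolding ypow_def
    by (intro ml_eq_at_0_mult ml_eq_at_0_one_plus_var_pow ml_eq_at_0_refl ml_ord_ge_mult_0 ml_ord_ge_yprod)
  have yp: "yprod (as @ y # cs) (bs @ b # ds) = ypow y b * (yprod as bs * yprod cs ds)"
    using assms(2) by (simp add: yprod_append mult_ac)
  have "ml_eq_at_0 y (?C * (tprod (as @ y # cs) * yprod (as @ y # cs) (bs @ b # ds)))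
      (?C * ((tprod (as @ cs) * (?A * ?B)) * (1 * (yprod as bs * yprod cs ds))))"
    unfolding tprod_insert yp
    by (intro ml_eq_at_0_mult[OF _ ml_eq_at_0_mult[OF ml_eq_at_0_mult[OF _ ml_eq_at_0_mult[OF A B]] P]]
        ml_eq_at_0_refl C ml_ord_ge_tprod)
  then have "ml_constant_term (?C * (tprod (as @ y # cs) * yprod (as @ y # cs) (bs @ b # ds))) =
      ml_constant_term (?C * ((tprod (as @ cs) * (?A * ?B)) * (1 * (yprod as bs * yprod cs ds))))"
    by (rule ml_constant_term_eq_at_0)
  also have "?C * ((tprod (as @ cs) * (?A * ?B)) * (1 * (yprod as bs * yprod cs ds))) =
      qser k (as @ cs) * (down as bs * up cs ds)"
    using assms by (simp add: up_down_eq qser_def mult_ac)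
  finally show ?thesis .
qed

text \<open>In the expansion along the column of ones, the variable at position \<open>j\<close> has
  no negative power in the \<open>j\<close>-th summand. Setting it to zero gives the term of
  \<open>lser\<close> that omits the entry \<open>bs ! j\<close>.\<close>

lemma hser_lser:
  assumes "distinct xs" "distinct zs" "length xs = Suc (length zs)" "zs \<noteq> []" "length bs = length xs"
  shows "hser k xs bs = ml_constant_term (qser k zs * lser zs bs)"
proof -
  let ?W = "\<lambda>x. ml_var_pow x (- 1) :: 'a mlaurent"
  let ?N = "length xs"
  define C where "C j = (- 1) ^ j * (\<Prod>x\<leftarrow>del_nth j xs. ?W x) *
       (vand (map ?W (del_nth j xs)) * hsym k (del_nth j xs))" for j
  have len: "2 \<le> length xs" using assms by (cases zs) auto
  have "hser k xs bs = ml_constant_term ((\<Sum>j<?N. C j) * (tprod xs * yprod xs bs))"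
    unfolding hser_def qser_def C_def vand_hsym_expansion[OF len] by (simp add: mult.assoc)
  also have "\<dots> = (\<Sum>j<?N. ml_constant_term (C j * (tprod xs * yprod xs bs)))"
    by (simp add: sum_distrib_right ml_constant_term_simps)
  also have "\<dots> = (\<Sum>j<?N. ml_constant_term
      (qser k zs * (down (take j zs) (take j bs) * up (drop j zs) (drop (Suc j) bs))))"
  proof (rule sum.cong)
    fix j assume "j \<in> {..<?N}"
    then have j: "j < length xs" "j < length bs" using assms by auto
    let ?as = "take j xs" and ?cs = "drop (Suc j) xs"
    have xs: "xs = ?as @ xs ! j # ?cs" using j(1) by (rule id_take_nth_drop)
    have bs: "bs = take j bs @ bs ! j # drop (Suc j) bs" using j(2) by (rule id_take_nth_drop)
    \<comment> \<open>The term is viewed as a function of the variable list, invariant under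
      exchanges, in order to rename the remaining variables to \<open>zs\<close>.\<close>
    define F where "F ws = ml_constant_term
      (qser k ws * (down (take j ws) (take j bs) * up (drop j ws) (drop (Suc j) bs)))" for ws
    have "distinct (?as @ xs ! j # ?cs)" using assms(1) xs by simp
    then have "ml_constant_term ((- 1) ^ length ?as * (\<Prod>x\<leftarrow>?as @ ?cs. ?W x) *
      (vand (map ?W (?as @ ?cs)) * hsym k (?as @ ?cs)) *
      (tprod (?as @ xs ! j # ?cs) * yprod (?as @ xs ! j # ?cs) (take j bs @ bs ! j # drop (Suc j) bs))) =
      ml_constant_term (qser k (?as @ ?cs) * (down ?as (take j bs) * up ?cs (drop (Suc j) bs)))"
      by (rule constant_term_insert) (use assms in auto)
    then have "ml_constant_term (C j * (tprod xs * yprod xs bs)) =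
      ml_constant_term (qser k (?as @ ?cs) * (down ?as (take j bs) * up ?cs (drop (Suc j) bs)))"
      unfolding xs[symmetric] bs[symmetric] C_def del_nth_def using j by simp
    also have "\<dots> = F (?as @ ?cs)" unfolding F_def using j by simp
    also have "\<dots> = F zs"
    proof (rule swap_invariant_eq)
      fix p q ws
      show "F (map (transpose p q) ws) = F ws"
        using ml_constant_term_swap[of p q
            "qser k ws * (down (take j ws) (take j bs) * up (drop j ws) (drop (Suc j) bs))"]
        by (simp add: F_def take_map drop_map)
      have "distinct (?as @ xs ! j # ?cs)" using assms(1) xs by simp
      then show "distinct (?as @ ?cs)" by simp
    qed (use assms j in auto)
    finally show "ml_constant_term (C j * (tprod xs * yprod xs bs)) = ml_constant_term
      (qser k zs * (down (take j zs) (take j bs) * up (drop j zs) (drop (Suc j) bs)))"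
      unfolding F_def .
  qed simp
  also have "{..<?N} = {..length zs}" using assms(3) by auto
  finally show ?thesis
    by (simp add: lser_def sum_distrib_left ml_constant_term_simps)
qed

lemma hser_rser:
  assumes "distinct xs" "distinct zs" "length xs = Suc (length zs)" "zs \<noteq> []" "length bs = length xs"
  shows "hser k xs bs = ml_constant_term (qser k zs * rser zs bs)"
proof -
  have "ml_constant_term (qser k zs * (1 * rser zs bs)) = ml_constant_term (qser k zs * (1 * lser zs bs))"
    using assms by (intro constant_term_rser) (auto simp: qser_antisymmetric simp del: ml_swap_ring(7))
  then show ?thesis using hser_lser[OF assms] by simp
qed

text \<open>For one variable \<open>hsym k\<close> is x^-k, so the constant term is the coefficient
  of x^k in a binomial power, whose exponent is non-negative by hypothesis.\<close>

lemma hser_single: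
  assumes "\<alpha> \<le> b"
  shows "hser k [x] [b] = of_nat (nat (b - \<alpha>) choose k)"
proof -
  let ?n = "nat (b - \<alpha>)"
  have "ypow x b = (ml_var x + 1) ^ ?n"
    using assms by (simp add: ypow_def ml_one_plus_var_pow_def add.commute)
  also have "\<dots> = (\<Sum>i\<le>?n. of_nat (?n choose i) * ml_var_pow x (int i))"
    by (simp add: binomial_ring ml_var_pow_power)
  also have "\<dots> = (\<Sum>i\<le>?n. ml_const (of_nat (?n choose i)) * ml_var_pow x (int i))"
    by (simp only: of_nat_eq_ml_const)
  finally have "qser k [x] * yprod [x] [b] =
      (\<Sum>i\<le>?n. ml_const (of_nat (?n choose i)) * ml_var_pow x (int i - int k))"
    by (simp add: qser_def hsym_def geometric_z_def sum_distrib_left mult.left_commute[of "ml_var_pow x (- int k)"]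
        ml_var_pow_mult)
  then have "hser k [x] [b] = (\<Sum>i\<le>?n. of_nat (?n choose i) * (if i = k then 1 else 0))"
    unfolding hser_def by (simp add: ml_constant_term_simps ml_constant_term_var_pow)
  then show ?thesis by (simp add: mult_delta_right binomial_eq_0)
qed

end

section \<open>Interlacing rows\<close>

text \<open>Strictness is kept apart, because the geometric sums run over weakly increasing rows as
  well and \<open>row_coeff\<close> has to remove the others.\<close>

definition interlacing :: "int list \<Rightarrow> int list set" where
  "interlacing bs =
     {ls. length bs = Suc (length ls) \<and> (\<forall>i<length ls. bs ! i \<le> ls ! i \<and> ls ! i \<le> bs ! Suc i)}"

lemma interlacing_Cons_iff:
  "l # ls \<in> interlacing (b # c # bs) \<longleftrightarrow> b \<le> l \<and> l \<le> c \<and> ls \<in> interlacing (c # bs)"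
  by (auto simp: interlacing_def nth_Cons split: nat.splits)

lemma interlacing_single: "interlacing [b] = {[]}"
  by (auto simp: interlacing_def)

lemma interlacing_Cons: "interlacing (b # c # bs) = (\<lambda>(l, ls). l # ls) ` ({b..c} \<times> interlacing (c # bs))"
proof (intro set_eqI iffI)
  fix ls assume ls: "ls \<in> interlacing (b # c # bs)"
  then obtain k ks where "ls = k # ks" by (cases ls) (auto simp: interlacing_def)
  then show "ls \<in> (\<lambda>(l, ls). l # ls) ` ({b..c} \<times> interlacing (c # bs))"
    using ls by (auto simp: interlacing_Cons_iff)
qed (auto simp: interlacing_Cons_iff)

lemma sum_interlacing:
  "(\<Sum>ls\<in>interlacing (b # c # bs). F ls) = (\<Sum>l\<in>{b..c}. \<Sum>ls\<in>interlacing (c # bs). F (l # ls))"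
proof -
  have "(\<Sum>ls\<in>interlacing (b # c # bs). F ls) = (\<Sum>(l, ls)\<in>{b..c} \<times> interlacing (c # bs). F (l # ls))"
    unfolding interlacing_Cons by (subst sum.reindex) (auto simp: inj_on_def intro!: sum.cong)
  then show ?thesis by (simp add: sum.cartesian_product)
qed

lemma finite_interlacing: "finite (interlacing bs)"
proof (induction bs)
  case Nil
  then show ?case by (simp add: interlacing_def)
next
  case (Cons b bs)
  then show ?case by (cases bs) (simp_all add: interlacing_single interlacing_Cons)
qed

lemma interlacing_sorted:
  assumes "ls \<in> interlacing bs"
  shows "sorted ls"
  unfolding sorted_iff_nth_Suc
proof (intro allI impI)
  fix i assume "Suc i < length ls"
  then have "ls ! i \<le> bs ! Suc i" "bs ! Suc i \<le> ls ! Suc i"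
    using assms by (auto simp: interlacing_def)
  then show "ls ! i \<le> ls ! Suc i" by simp
qed

text \<open>
  When \<open>p = q = l\<close> the boundary coefficient is \<open>u + v - 1\<close>, which is the weight \<open>1\<close> required for
  weakly increasing rows only if \<open>u = v = 1\<close>.
\<close>

definition entry_coeff :: "'a \<Rightarrow> 'a \<Rightarrow> int \<Rightarrow> int \<Rightarrow> int \<Rightarrow> 'a::comm_ring_1" where
  "entry_coeff u v p q l =
     (if l = q then u else 0) + (if l < q then 1 else 0) + (if l = p then v - 1 else 0)"

text \<open>Inclusion-exclusion over the pairs of adjacent equal entries, as long as no three entries agree.\<close>

fun row_coeff :: "'a \<Rightarrow> 'a \<Rightarrow> int list \<Rightarrow> int list \<Rightarrow> 'a::comm_ring_1" where
  "row_coeff u v (b # c # bs) (l # k # ls) = entry_coeff u v b c l * row_coeff u v (c # bs) (k # ls) -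
     (if l = c \<and> k = c then u * v * row_coeff u v bs ls else 0)"
| "row_coeff u v (b # c # bs) [l] = entry_coeff u v b c l"
| "row_coeff u v _ _ = 1"

definition row_weight :: "'a \<Rightarrow> 'a \<Rightarrow> int list \<Rightarrow> int list \<Rightarrow> 'a::comm_ring_1" where
  "row_weight u v bs ls =
     u ^ card {i. i < length ls \<and> ls ! i = bs ! Suc i} * v ^ card {i. i < length ls \<and> ls ! i = bs ! i}"

lemma row_weight_Nil [simp]: "row_weight u v bs [] = 1"
  by (simp add: row_weight_def)

lemma row_weight_Cons:
  "row_weight u v (b # c # bs) (l # ls) =
     (if l = c then u else 1) * (if l = b then v else 1) * row_weight u v (c # bs) ls"
proof -
  have card: "card {i. i < Suc n \<and> P i} = (if P 0 then 1 else 0) + card {i. i < n \<and> P (Suc i)}" for P n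
  proof -
    have "{i. i < Suc n \<and> P i} = (if P 0 then {0} else {}) \<union> Suc ` {i. i < n \<and> P (Suc i)}"
      by (auto simp: image_iff less_Suc_eq_0_disj)
    then show ?thesis by (simp add: card_image card_insert_if)
  qed
  show ?thesis by (simp add: row_weight_def card mult_ac)
qed

text \<open>For strict \<open>bs\<close> the entry coefficients are exactly the weights. Equal
  neighbours must both be the entry \<open>c\<close> between them, with weights \<open>u\<close> and
  \<open>v\<close>, and the subtracted term cancels this product.\<close>

lemma row_coeff_strict:
  assumes "sorted_wrt (<) bs" "ls \<in> interlacing bs"
  shows "row_coeff u v bs ls = (if sorted_wrt (<) ls then row_weight u v bs ls else 0)"
  using assms
proof (induction u v bs ls rule: row_coeff.induct)
  case (1 u v b c bs l k ls)
  obtain d bs' where bs: "bs = d # bs'"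
    using 1 by (cases bs) (auto simp: interlacing_Cons_iff interlacing_def)
  have iv: "b \<le> l" "l \<le> c" "c \<le> k" "k \<le> d" "ls \<in> interlacing bs" "k # ls \<in> interlacing (c # bs)"
    using 1 by (auto simp: interlacing_Cons_iff bs)
  have lt: "b < c" "c < d" using 1 by (auto simp: bs)
  have IH1: "row_coeff u v (c # bs) (k # ls) =
      (if sorted_wrt (<) (k # ls) then row_weight u v (c # bs) (k # ls) else 0)"
    using 1 iv by auto
  have IH2: "row_coeff u v bs ls = (if sorted_wrt (<) ls then row_weight u v bs ls else 0)"
    if "l = c" "k = c"
    using 1 iv that by auto
  show ?case
  proof (cases "l < k")
    case True
    then show ?thesis using iv lt IH1 by (auto simp: row_weight_Cons entry_coeff_def)
  next
    case False
    then have eq: "l = c" "k = c" using iv by auto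
    \<comment> \<open>The entry after the equal pair is at least \<open>d\<close>, and
      \<open>c < d\<close>. Hence the remaining row is strict with \<open>k\<close> in front exactly
      when it is strict without it, as the cancellation requires.\<close>
    have "k < m" if "ls = m # ls'" for m ls'
      using iv(5) lt eq that by (cases bs') (auto simp: bs interlacing_Cons_iff interlacing_def)
    then have "sorted_wrt (<) (k # ls) \<longleftrightarrow> sorted_wrt (<) ls"
      by (cases ls) (simp, auto simp del: sorted_wrt.simps(2) simp: sorted_wrt2)
    then show ?thesis using eq lt IH1 IH2 by (auto simp: bs row_weight_Cons entry_coeff_def)
  qed
next
  case (2 u v b c bs l)
  then show ?case by (auto simp: row_weight_Cons entry_coeff_def interlacing_Cons_iff)
qed (auto simp: interlacing_def row_weight_def)

text \<open>At \<open>u = v = 1\<close> every admissible entry has coefficient 1, also when its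
  interval is a point. An equal pair cancels as 1 - 1, the second assumption ensuring that the entry
  after the pair is larger.\<close>

lemma row_coeff_one:
  assumes "ls \<in> interlacing bs" "\<And>i. Suc (Suc i) < length ls \<Longrightarrow> ls ! i < ls ! Suc (Suc i)"
  shows "row_coeff 1 1 bs ls = (if sorted_wrt (<) ls then 1 else (0 :: 'a::comm_ring_1))"
  using assms
proof (induction "1 :: 'a" "1 :: 'a" bs ls rule: row_coeff.induct)
  case (1 b c bs l k ls)
  obtain d bs' where bs: "bs = d # bs'"
    using 1 by (cases bs) (auto simp: interlacing_Cons_iff interlacing_def)
  have iv: "b \<le> l" "l \<le> c" "c \<le> k" "ls \<in> interlacing bs" "k # ls \<in> interlacing (c # bs)"
    using 1 by (auto simp: interlacing_Cons_iff bs)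
  have lt: "Suc (Suc i) < length (k # ls) \<Longrightarrow> (k # ls) ! i < (k # ls) ! Suc (Suc i)"
      "Suc (Suc i) < length ls \<Longrightarrow> ls ! i < ls ! Suc (Suc i)" for i
    using "1.prems"(2)[of "Suc i"] "1.prems"(2)[of "Suc (Suc i)"] by auto
  have IH1: "row_coeff 1 1 (c # bs) (k # ls) = (if sorted_wrt (<) (k # ls) then 1 else (0 :: 'a))"
    by (rule "1.hyps"(1)) (use iv lt in auto)
  have e: "entry_coeff 1 1 b c l = (1 :: 'a)" using iv by (auto simp: entry_coeff_def)
  show ?case
  proof (cases "l < k")
    case True
    then show ?thesis using iv IH1 e by auto
  next
    case False
    then have eq: "l = c" "k = c" using iv by auto
    have IH2: "row_coeff 1 1 bs ls = (if sorted_wrt (<) ls then 1 else (0 :: 'a))"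
      by (rule "1.hyps"(2)) (use eq iv lt in auto)
    have "k < m" if "ls = m # ls'" for m ls'
      using "1.prems"(2)[of 0] that eq by simp
    then have "sorted_wrt (<) (k # ls) \<longleftrightarrow> sorted_wrt (<) ls"
      by (cases ls) (simp, auto simp del: sorted_wrt.simps(2) simp: sorted_wrt2)
    then show ?thesis using eq IH1 IH2 e by simp
  qed
next
  case (2 b c bs l)
  then show ?case by (auto simp: entry_coeff_def interlacing_Cons_iff)
qed (auto simp: interlacing_def)

section \<open>Summing the series over interlacing rows\<close>

lemma sum_ypow:
  assumes "p \<le> q"
  shows "(\<Sum>l\<in>{p..<q}. ypow \<alpha> x l :: 'a::{idom, ring_char_0} mlaurent) = ml_var_pow x (- 1) * (ypow \<alpha> x q - ypow \<alpha> x p)"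
  using assms
proof (induction q rule: int_ge_induct)
  case (step q)
  let ?W = "ml_var_pow x (- 1) :: 'a mlaurent" and ?y = "ypow \<alpha> x q :: 'a mlaurent"
  have "ypow \<alpha> x (q + 1) = (1 + ml_var x) * ?y"
    using ml_one_plus_var_pow_Suc[of x "q - \<alpha>", where 'a = 'a] by (simp add: ypow_def algebra_simps)
  then have "?W * ypow \<alpha> x (q + 1) = ?W * ?y + (?W * ml_var x) * ?y"
    by (simp only: distrib_left distrib_right mult_1_left mult.assoc)
  then have "?W * ypow \<alpha> x (q + 1) = ?W * ?y + ?y"
    by (simp add: ml_var_inverse)
  moreover have "{p..<q + 1} = insert q {p..<q}" using step by auto
  ultimately show ?case using step by (simp add: right_diff_distrib)
qed simp

lemma sum_entry_coeff:
  fixes u v :: "'a::{idom, ring_char_0}"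
  assumes "p \<le> q"
  shows "(\<Sum>l\<in>{p..q}. ml_const (entry_coeff u v p q l) * ypow \<alpha> x l) = up1 u \<alpha> x q + down1 v \<alpha> x p"
proof -
  have "ml_const (entry_coeff u v p q l) * ypow \<alpha> x l =
      (if l = q then ml_const u * ypow \<alpha> x l else 0) + (if l < q then ypow \<alpha> x l else 0) +
      (if l = p then ml_const (v - 1) * ypow \<alpha> x l else 0)" for l
    by (auto simp: entry_coeff_def ml_const_add ml_const_diff algebra_simps)
  moreover have "(\<Sum>l\<in>{p..q}. if l < q then ypow \<alpha> x l else 0) = (\<Sum>l\<in>{p..<q}. ypow \<alpha> x l :: 'a mlaurent)"
    by (rule sum.mono_neutral_cong_right) auto
  ultimately have "(\<Sum>l\<in>{p..q}. ml_const (entry_coeff u v p q l) * ypow \<alpha> x l) =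
      ml_const u * ypow \<alpha> x q + ml_var_pow x (- 1) * (ypow \<alpha> x q - ypow \<alpha> x p) +
      ml_const (v - 1) * ypow \<alpha> x p"
    using assms by (simp add: sum.distrib sum_ypow)
  \<comment> \<open>The end corrections receive a factor 1 so that everything has the common factor
    \<open>ml_var_pow x (- 1)\<close> of \<open>up1\<close> and \<open>down1\<close>.\<close>
  also have "\<dots> = (ml_var_pow x (- 1) * ml_var x) * ml_const u * ypow \<alpha> x q +
      ml_var_pow x (- 1) * (ypow \<alpha> x q - ypow \<alpha> x p) +
      (ml_var_pow x (- 1) * ml_var x) * ml_const (v - 1) * ypow \<alpha> x p"
    by (simp add: ml_var_inverse)
  also have "\<dots> = up1 u \<alpha> x q + down1 v \<alpha> x p"
    by (simp add: up1_def down1_def ml_const_diff algebra_simps)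
  finally show ?thesis .
qed

text \<open>Both sides obey the same recursion: summing the first entry gives
  \<open>up1 + down1\<close>, and the subtracted term fixes the first two entries at
  \<open>c\<close>, leaving a sum over the rows above \<open>bs\<close>.\<close>

lemma rser_eq_sum:
  fixes u v :: "'a::{idom, ring_char_0}"
  assumes "length bs = Suc (length xs)" "sorted bs"
  shows "rser u v \<alpha> xs bs = (\<Sum>ls\<in>interlacing bs. ml_const (row_coeff u v bs ls) * yprod \<alpha> xs ls)"
  using assms
proof (induction xs bs rule: rser.induct)
  case (1 x z xs b c bs)
  obtain d bs' where bs: "bs = d # bs'" using 1 by (cases bs) auto
  have le: "b \<le> c" "c \<le> d" using 1 by (auto simp: bs)
  let ?S = "\<Sum>ls\<in>interlacing bs. ml_const (row_coeff u v bs ls) * yprod \<alpha> xs ls"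
  let ?f = "\<lambda>l. ml_const (entry_coeff u v b c l) * ypow \<alpha> x l"
  let ?g = "\<lambda>k ls. ml_const (row_coeff u v (c # bs) (k # ls)) * yprod \<alpha> (z # xs) (k # ls)"
  let ?h = "\<lambda>l k ls. if l = c then if k = c then ml_const (u * v) * (ypow \<alpha> x c * ypow \<alpha> z c) *
        (ml_const (row_coeff u v bs ls) * yprod \<alpha> xs ls) else 0 else 0"
  have "ml_const (row_coeff u v (b # c # bs) (l # k # ls)) * yprod \<alpha> (x # z # xs) (l # k # ls) =
      ?f l * ?g k ls - ?h l k ls" for l k ls
    by (simp add: ml_const_mult ml_const_diff algebra_simps)
  then have "(\<Sum>ls\<in>interlacing (b # c # bs). ml_const (row_coeff u v (b # c # bs) ls) * yprod \<alpha> (x # z # xs) ls) =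
      (\<Sum>l\<in>{b..c}. \<Sum>k\<in>{c..d}. \<Sum>ls\<in>interlacing bs. ?f l * ?g k ls - ?h l k ls)"
    by (simp only: bs sum_interlacing)
  also have "\<dots> = (\<Sum>l\<in>{b..c}. ?f l * (\<Sum>k\<in>{c..d}. \<Sum>ls\<in>interlacing bs. ?g k ls)) -
      (\<Sum>l\<in>{b..c}. \<Sum>k\<in>{c..d}. \<Sum>ls\<in>interlacing bs. ?h l k ls)"
    by (simp only: sum_subtractf sum_distrib_left)
  also have "(\<Sum>l\<in>{b..c}. ?f l * (\<Sum>k\<in>{c..d}. \<Sum>ls\<in>interlacing bs. ?g k ls)) =
      (up1 u \<alpha> x c + down1 v \<alpha> x b) * rser u v \<alpha> (z # xs) (c # bs)"
    using 1 le by (simp only: sum_distrib_right[symmetric] sum_entry_coeff) (simp add: bs sum_interlacing)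
  also have "(\<Sum>l\<in>{b..c}. \<Sum>k\<in>{c..d}. \<Sum>ls\<in>interlacing bs. ?h l k ls) =
      ml_const (u * v) * (ypow \<alpha> x c * ypow \<alpha> z c) * ?S" (is "_ = ?T")
  proof -
    have "(\<Sum>ls\<in>interlacing bs. ?h l k ls) = (if l = c then if k = c then ?T else 0 else 0)" for l k
      by (simp add: sum_distrib_left)
    moreover have "(\<Sum>k\<in>{c..d}. if l = c then if k = c then ?T else 0 else 0) = (if l = c then ?T else 0)" for l
      using le by simp
    ultimately show ?thesis using le by simp
  qed
  also have "?S = rser u v \<alpha> xs bs"
    using 1 by simp
  finally show ?case by simp
next
  case (2 x b c bs)
  then have "bs = []" by simp
  then show ?case using 2 sum_entry_coeff[of b c u v \<alpha> x] by (simp add: sum_interlacing interlacing_single)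
next
  case ("3_1" bs)
  then obtain b where "bs = [b]" by (cases bs) auto
  then show ?case by (simp add: interlacing_single)
qed (auto simp: interlacing_single)

lemma hser_row_sum:
  fixes u v :: "'a::{idom, ring_char_0}"
  assumes "distinct xs" "distinct zs" "length xs = Suc (length zs)" "zs \<noteq> []" "length bs = length xs"
    and "sorted bs"
  shows "hser u v \<alpha> k xs bs = (\<Sum>ls\<in>interlacing bs. row_coeff u v bs ls * hser u v \<alpha> k zs ls)"
proof -
  have "hser u v \<alpha> k xs bs = ml_constant_term
      (\<Sum>ls\<in>interlacing bs. ml_const (row_coeff u v bs ls) * (qser u v k zs * yprod \<alpha> zs ls))"
    using assms by (simp add: hser_rser[of xs zs] rser_eq_sum sum_distrib_left mult.left_commute)
  then show ?thesis by (simp add: ml_constant_term_simps hser_def)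
qed

section \<open>Removing the bottom row of a monotone triangle\<close>

definition triangles_above :: "int list \<Rightarrow> (nat \<times> nat \<Rightarrow> int) set" where
  "triangles_above bs =
     {m \<in> monotone_triangles (length bs). \<forall>i<length bs. m (length bs, Suc i) = bs ! i}"

text \<open>The function \<open>\<phi>\<close> of the top entry is left free: it is a binomial
  coefficient in the induction over rows and the indicator of \<open>a\<close> in the final
  identity.\<close>

definition triangle_sum :: "'a \<Rightarrow> 'a \<Rightarrow> (int \<Rightarrow> 'a) \<Rightarrow> int list \<Rightarrow> 'a::comm_ring_1" where
  "triangle_sum u v \<phi> bs = (\<Sum>m\<in>triangles_above bs.
     u ^ mt_inv (length bs) m * v ^ mt_inv' (length bs) m * \<phi> (m (1, 1)))"

lemma triangle_top_bounds:
  assumes "m \<in> triangles_above bs" "bs \<noteq> []"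
  shows "bs ! 0 \<le> m (1, 1) \<and> m (1, 1) \<le> last bs"
proof -
  obtain n where n: "length bs = Suc n" using assms(2) by (cases bs) auto
  have "m \<in> monotone_triangles (Suc n)" and row: "\<forall>i<Suc n. m (Suc n, Suc i) = bs ! i"
    using assms(1) n by (auto simp: triangles_above_def)
  then have "m (Suc n, 1) \<le> m (1, 1) \<and> m (1, 1) \<le> m (Suc n, 1 + (Suc n - 1))"
    by (intro monotone_triangle_bounds) auto
  then show ?thesis using row assms(2) n by (simp add: last_conv_nth)
qed

lemma finite_triangles_above:
  assumes "bs \<noteq> []"
  shows "finite (triangles_above bs)"
proof (rule finite_subset)
  show "triangles_above bs \<subseteq>
      (\<Union>a\<in>{bs ! 0..last bs}. monotone_triangles_with (length bs) (\<lambda>j. bs ! (j - 1)) a)"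
  proof
    fix m assume m: "m \<in> triangles_above bs"
    have "m (length bs, j) = bs ! (j - 1)" if j: "j \<in> {1..length bs}" for j
    proof -
      obtain i where "j = Suc i" using j by (cases j) auto
      then show ?thesis using m j by (simp add: triangles_above_def)
    qed
    then show "m \<in> (\<Union>a\<in>{bs ! 0..last bs}. monotone_triangles_with (length bs) (\<lambda>j. bs ! (j - 1)) a)"
      using m triangle_top_bounds[OF m assms]
      by (auto simp: monotone_triangles_with_def triangles_above_def)
  qed
qed (simp add: finite_monotone_triangles_with)

lemma triangle_sum_single: "triangle_sum u v \<phi> [b] = \<phi> b"
proof -
  have cells: "triangle_cells 1 = {(1, 1)}" by (auto simp: triangle_cells_def)
  have "triangles_above [b] = {restrict (\<lambda>_. b) {(1, 1)}}"
    unfolding triangles_above_def monotone_triangles_def length_Cons list.size(3) One_nat_def[symmetric] cells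
    by (auto intro!: extensionalityI[of _ "{(1, 1)}"])
  moreover have "{(i :: nat, j :: nat). 1 \<le> j \<and> j \<le> i \<and> i < Suc 0 \<and> P i j} = {}" for P by auto
  then have "mt_inv (Suc 0) m = 0" "mt_inv' (Suc 0) m = 0" for m
    unfolding mt_inv_def mt_inv'_def by (simp_all only: card.empty)
  ultimately show ?thesis by (simp add: triangle_sum_def)
qed

text \<open>Two neighbouring entries of the row above lie between \<open>bs ! i\<close> and
  \<open>bs ! Suc (Suc i)\<close>, yet that row must be strict.\<close>

lemma triangles_above_eq_empty:
  assumes "Suc (Suc i) < length bs" "bs ! i = bs ! Suc (Suc i)"
  shows "triangles_above bs = {}"
proof -
  have False if m: "m \<in> triangles_above bs" for m
  proof -
    obtain n where n: "length bs = Suc n" using assms(1) by (cases "length bs") auto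
    have mono: "m (i + 1, j) \<le> m (i, j) \<and> m (i, j) \<le> m (i + 1, j + 1)"
      if "1 \<le> j" "j \<le> i" "i < Suc n" for i j
      using m that unfolding triangles_above_def monotone_triangles_def n by blast
    have strict: "m (i, j) < m (i, j + 1)" if "1 \<le> j" "j < i" "i < Suc n" for i j
      using m that unfolding triangles_above_def monotone_triangles_def n by blast
    have row: "m (n + 1, Suc k) = bs ! k" if "k < Suc n" for k
      using m that by (simp add: triangles_above_def n)
    show False
      using mono[of "Suc i" n] mono[of "Suc i + 1" n] strict[of "Suc i" n] row[of i]
        row[of "Suc (Suc i)"] assms n
      by simp
  qed
  then show ?thesis by blast
qed

lemma card_pairs_split:
  "card {(i, j). 1 \<le> j \<and> j \<le> i \<and> i < Suc n \<and> P i j} =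
     card {(i, j). 1 \<le> j \<and> j \<le> i \<and> i < n \<and> P i j} + card {i. i < n \<and> P n (Suc i)}"
proof -
  have split: "{(i, j). 1 \<le> j \<and> j \<le> i \<and> i < Suc n \<and> P i j} =
      {(i, j). 1 \<le> j \<and> j \<le> i \<and> i < n \<and> P i j} \<union> (\<lambda>i. (n, Suc i)) ` {i. i < n \<and> P n (Suc i)}" (is "?L = ?R")
  proof (intro set_eqI iffI)
    fix p assume p: "p \<in> ?L"
    obtain i j where [simp]: "p = (i, j)" by force
    show "p \<in> ?R"
    proof (cases "i = n")
      case True
      then have "(n, j) = (n, Suc (j - 1))" "j - 1 < n" "P n (Suc (j - 1))" using p by auto
      then show ?thesis using True by (auto intro!: image_eqI[of _ _ "j - 1"])
    qed (use p in auto)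
  qed auto
  have fin: "finite {(i, j). 1 \<le> j \<and> j \<le> i \<and> i < n \<and> P i j}"
    by (rule finite_subset[of _ "{..n} \<times> {..n}"]) auto
  have card: "card ((\<lambda>i. (n, Suc i)) ` {i. i < n \<and> P n (Suc i)}) = card {i. i < n \<and> P n (Suc i)}"
    by (rule card_image) (simp add: inj_on_def)
  have disj: "{(i, j). 1 \<le> j \<and> j \<le> i \<and> i < n \<and> P i j} \<inter>
      (\<lambda>i. (n, Suc i)) ` {i. i < n \<and> P n (Suc i)} = {}"
    by auto
  show ?thesis unfolding split by (subst card_Un_disjoint[OF fin _ disj]) (simp_all only: card, simp)
qed

lemma mt_inv_Suc:
  "mt_inv (Suc n) m = mt_inv n (restrict m (triangle_cells n)) +
     card {i. i < n \<and> m (n, Suc i) = m (Suc n, Suc (Suc i))}"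
  "mt_inv' (Suc n) m = mt_inv' n (restrict m (triangle_cells n)) +
     card {i. i < n \<and> m (n, Suc i) = m (Suc n, Suc i)}"
proof -
  have "{(i, j). 1 \<le> j \<and> j \<le> i \<and> i < n \<and> restrict m (triangle_cells n) (i, j) =
        restrict m (triangle_cells n) (i + 1, j + 1)} =
      {(i, j). 1 \<le> j \<and> j \<le> i \<and> i < n \<and> m (i, j) = m (i + 1, j + 1)}"
    "{(i, j). 1 \<le> j \<and> j \<le> i \<and> i < n \<and> restrict m (triangle_cells n) (i, j) =
        restrict m (triangle_cells n) (i + 1, j)} =
      {(i, j). 1 \<le> j \<and> j \<le> i \<and> i < n \<and> m (i, j) = m (i + 1, j)}"
    by (auto simp: triangle_cells_def)
  then show "mt_inv (Suc n) m = mt_inv n (restrict m (triangle_cells n)) +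
     card {i. i < n \<and> m (n, Suc i) = m (Suc n, Suc (Suc i))}"
    "mt_inv' (Suc n) m = mt_inv' n (restrict m (triangle_cells n)) +
     card {i. i < n \<and> m (n, Suc i) = m (Suc n, Suc i)}"
    unfolding mt_inv_def mt_inv'_def card_pairs_split by simp_all
qed

lemma monotone_triangles_undefined:
  "m \<in> monotone_triangles n \<Longrightarrow> q \<notin> triangle_cells n \<Longrightarrow> m q = undefined"
  unfolding monotone_triangles_def extensional_def by blast

text \<open>In the restriction row \<open>n\<close> is the bottom row and may have equal entries;
  below a further row it must be strict, hence the last condition.\<close>

lemma monotone_triangles_Suc:
  "m \<in> monotone_triangles (Suc n) \<longleftrightarrow> m \<in> extensional (triangle_cells (Suc n)) \<and>
     restrict m (triangle_cells n) \<in> monotone_triangles n \<and>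
     (\<forall>i<n. m (Suc n, Suc i) \<le> m (n, Suc i) \<and> m (n, Suc i) \<le> m (Suc n, Suc (Suc i))) \<and>
     (\<forall>i. Suc i < n \<longrightarrow> m (n, Suc i) < m (n, Suc (Suc i)))"
  (is "_ \<longleftrightarrow> ?ext \<and> ?low \<and> ?mono \<and> ?strict")
proof -
  define M where "M i j \<longleftrightarrow> m (i + 1, j) \<le> m (i, j) \<and> m (i, j) \<le> m (i + 1, j + 1)" for i j
  define S where "S i j \<longleftrightarrow> m (i, j) < m (i, j + 1)" for i j
  have low: "?low \<longleftrightarrow> (\<forall>i j. 1 \<le> j \<and> j \<le> i \<and> i < n \<longrightarrow> M i j) \<and>
      (\<forall>i j. 1 \<le> j \<and> j < i \<and> i < n \<longrightarrow> S i j)"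
    by (auto simp: monotone_triangles_def triangle_cells_def M_def S_def)
  have shift: "(\<forall>i. Suc i \<le> k \<longrightarrow> P (Suc i)) \<longleftrightarrow> (\<forall>j. 1 \<le> j \<and> j \<le> k \<longrightarrow> P j)" for P and k :: nat
  proof (intro iffI allI impI)
    fix j assume "\<forall>i. Suc i \<le> k \<longrightarrow> P (Suc i)" "1 \<le> j \<and> j \<le> k"
    then show "P j" by (cases j) auto
  qed auto
  have mono: "?mono \<longleftrightarrow> (\<forall>j. 1 \<le> j \<and> j \<le> n \<longrightarrow> M n j)"
    unfolding shift[symmetric] by (simp add: M_def Suc_le_eq)
  have strict: "?strict \<longleftrightarrow> (\<forall>j. 1 \<le> j \<and> j < n \<longrightarrow> S n j)"
    using shift[of "n - 1" "S n"] by (cases n) (simp_all add: S_def less_Suc_eq_le)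
  have "m \<in> monotone_triangles (Suc n) \<longleftrightarrow> ?ext \<and>
      (\<forall>i j. 1 \<le> j \<and> j \<le> i \<and> i < Suc n \<longrightarrow> M i j) \<and> (\<forall>i j. 1 \<le> j \<and> j < i \<and> i < Suc n \<longrightarrow> S i j)"
    by (simp add: monotone_triangles_def M_def S_def)
  also have "\<dots> \<longleftrightarrow> ?ext \<and> ?low \<and> ?mono \<and> ?strict"
    unfolding low mono strict by (auto simp: less_Suc_eq)
  finally show ?thesis .
qed

text \<open>Cutting off the bottom row is a bijection onto pairs of a strict interlacing row and a
  triangle above it, and \<open>row_weight\<close> counts the equalities between the last two
  rows.\<close>

lemma triangle_sum_rows:
  assumes "length bs = Suc n" "1 \<le> n"
  shows "triangle_sum u v \<phi> bs =
    (\<Sum>ls\<in>{ls \<in> interlacing bs. sorted_wrt (<) ls}. row_weight u v bs ls * triangle_sum u v \<phi> ls)"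
proof -
  let ?S = "{ls \<in> interlacing bs. sorted_wrt (<) ls}"
  let ?C = "triangle_cells n"
  define row where "row m = map (\<lambda>i. m (n, Suc i)) [0..<n]" for m :: "nat \<times> nat \<Rightarrow> int"
  \<comment> \<open>The inverse map appends \<open>bs\<close> as row \<open>n + 1\<close>;
    \<open>snd p - 1\<close> converts a column, counted from 1, into a list position.\<close>
  define ext where "ext m p = (if fst p = Suc n \<and> 1 \<le> snd p \<and> snd p \<le> Suc n then bs ! (snd p - 1) else m p)"
    for m :: "nat \<times> nat \<Rightarrow> int" and p
  have len: "length ls = n" if "ls \<in> ?S" for ls using that assms(1) by (auto simp: interlacing_def)
  have "(\<Sum>ls\<in>?S. row_weight u v bs ls * triangle_sum u v \<phi> ls) =
      (\<Sum>ls\<in>?S. \<Sum>m\<in>triangles_above ls.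
         row_weight u v bs ls * (u ^ mt_inv n m * v ^ mt_inv' n m * \<phi> (m (1, 1))))"
    by (intro sum.cong refl) (simp add: triangle_sum_def sum_distrib_left len)
  also have "\<dots> = (\<Sum>(ls, m)\<in>Sigma ?S triangles_above.
         row_weight u v bs ls * (u ^ mt_inv n m * v ^ mt_inv' n m * \<phi> (m (1, 1))))"
  proof (rule sum.Sigma)
    show "finite ?S" by (simp add: finite_interlacing)
    show "\<forall>ls\<in>?S. finite (triangles_above ls)"
    proof
      fix ls assume "ls \<in> ?S"
      then have "ls \<noteq> []" using len assms(2) by fastforce
      then show "finite (triangles_above ls)" by (rule finite_triangles_above)
    qed
  qed
  also have "\<dots> = triangle_sum u v \<phi> bs"
    unfolding triangle_sum_def assms(1)
  proof (rule sum.reindex_bij_witness[of _ "\<lambda>m. (row m, restrict m ?C)" "\<lambda>(ls, m). ext m"])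
    fix p assume p: "p \<in> Sigma ?S triangles_above"
    obtain ls m where p_eq [simp]: "p = (ls, m)" by force
    have ls: "ls \<in> interlacing bs" "sorted_wrt (<) ls" and m: "m \<in> triangles_above ls" and l: "length ls = n"
      using p len by auto
    have row_m: "m (n, Suc i) = ls ! i" if "i < n" for i
      using m that by (simp add: triangles_above_def l)
    have mm: "m \<in> monotone_triangles n" using m by (simp add: triangles_above_def l)
    have ext_low: "ext m (i, j) = m (i, j)" if "i \<le> n" for i j using that by (simp add: ext_def)
    have ext_row: "ext m (Suc n, Suc i) = bs ! i" if "i \<le> n" for i using that by (simp add: ext_def)
    have restrict_ext: "restrict (ext m) ?C = m"
    proof
      fix q
      show "restrict (ext m) ?C q = m q"
      proof (cases "q \<in> ?C")
        case True
        then show ?thesis by (cases q) (simp add: triangle_cells_def ext_def)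
      next
        case False
        then show ?thesis using monotone_triangles_undefined[OF mm] by simp
      qed
    qed
    have "row (ext m) = ls" by (rule nth_equalityI) (simp_all add: row_def l ext_low row_m)
    then show "(row (case p of (ls, m) \<Rightarrow> ext m), restrict (case p of (ls, m) \<Rightarrow> ext m) ?C) = p"
      by (simp add: restrict_ext)
    have "ext m \<in> extensional (triangle_cells (Suc n))"
      unfolding extensional_def
    proof (intro CollectI allI impI)
      fix q assume q: "q \<notin> triangle_cells (Suc n)"
      then have "q \<notin> ?C" by (auto simp: triangle_cells_def)
      then have "m q = undefined" by (rule monotone_triangles_undefined[OF mm])
      then show "ext m q = undefined" using q by (auto simp: ext_def triangle_cells_def)
    qed
    then have "ext m \<in> monotone_triangles (Suc n)"
      unfolding monotone_triangles_Suc restrict_ext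
      using mm ls l sorted_wrt_nth_less[OF ls(2)]
      by (auto simp: ext_low ext_row row_m interlacing_def)
    then show "(case p of (ls, m) \<Rightarrow> ext m) \<in> triangles_above bs"
      by (auto simp: triangles_above_def assms(1) ext_row)
    have "ext m (1, 1) = m (1, 1)" using assms(2) by (simp add: ext_low)
    moreover have "mt_inv (Suc n) (ext m) = mt_inv n m + card {i. i < n \<and> ls ! i = bs ! Suc i}"
      "mt_inv' (Suc n) (ext m) = mt_inv' n m + card {i. i < n \<and> ls ! i = bs ! i}"
      unfolding mt_inv_Suc restrict_ext
      by (simp_all add: ext_low ext_row row_m Suc_le_eq cong: conj_cong)
    ultimately show "u ^ mt_inv (Suc n) (case p of (ls, m) \<Rightarrow> ext m) *
        v ^ mt_inv' (Suc n) (case p of (ls, m) \<Rightarrow> ext m) * \<phi> ((case p of (ls, m) \<Rightarrow> ext m) (1, 1)) =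
      (case p of (ls, m) \<Rightarrow> row_weight u v bs ls * (u ^ mt_inv n m * v ^ mt_inv' n m * \<phi> (m (1, 1))))"
      by (simp add: row_weight_def l power_add mult_ac)
  next
    fix m assume "m \<in> triangles_above bs"
    then have mm: "m \<in> monotone_triangles (Suc n)" and bot: "\<forall>i<Suc n. m (Suc n, Suc i) = bs ! i"
      by (auto simp: triangles_above_def assms(1))
    have "ext (restrict m ?C) q = m q" for q
    proof (cases "q \<in> triangle_cells (Suc n)")
      case True
      obtain i j where [simp]: "q = (i, j)" by force
      show ?thesis
      proof (cases "i = Suc n")
        case i: True
        then obtain k where "j = Suc k" "k < Suc n" using True by (cases j) (auto simp: triangle_cells_def)
        then show ?thesis using bot i by (simp add: ext_def)
      next
        case False
        then show ?thesis using True by (auto simp: ext_def triangle_cells_def)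
      qed
    next
      case False
      then have "m q = undefined" by (rule monotone_triangles_undefined[OF mm])
      moreover have "q \<notin> ?C" using False by (auto simp: triangle_cells_def)
      ultimately show ?thesis using False by (cases q) (auto simp: ext_def triangle_cells_def)
    qed
    then show "(case (row m, restrict m ?C) of (ls, m) \<Rightarrow> ext m) = m" by auto
    have "row m \<in> ?S"
      using mm bot assms(1) unfolding monotone_triangles_Suc
      by (auto simp: interlacing_def row_def sorted_wrt_iff_nth_Suc_transp)
    moreover have "restrict m ?C \<in> triangles_above (row m)"
      using mm unfolding monotone_triangles_Suc
      by (auto simp: triangles_above_def row_def triangle_cells_def)
    ultimately show "(row m, restrict m ?C) \<in> Sigma ?S triangles_above" by simp
  qed
  finally show ?thesis by simp
qed

lemma hser_eq_triangle_sum: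
  fixes u v :: "'a::{idom, ring_char_0}"
  assumes "bs \<noteq> []" "length xs = length bs" "distinct xs" "sorted bs" "\<alpha> \<le> bs ! 0"
    and "sorted_wrt (<) bs \<or> u = 1 \<and> v = 1"
  shows "hser u v \<alpha> k xs bs = triangle_sum u v (\<lambda>a. of_nat (nat (a - \<alpha>) choose k)) bs"
  using assms
proof (induction "length bs" arbitrary: xs bs)
  case (Suc n)
  let ?T = "triangle_sum u v (\<lambda>a. of_nat (nat (a - \<alpha>) choose k))"
  show ?case
  proof (cases "n = 0")
    case True
    then have "length bs = Suc 0" "length xs = Suc 0" using Suc.hyps(2) Suc.prems(2) by auto
    then obtain b x where "bs = [b]" "xs = [x]" by (auto simp: length_Suc_conv)
    then show ?thesis using Suc.prems by (simp add: hser_single triangle_sum_single)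
  next
    case False
    \<comment> \<open>Any list of \<open>n\<close> distinct variables would serve, as
      \<open>hser_row_sum\<close> relates arbitrary distinct lists.\<close>
    let ?zs = "[0..<n]"
    have IH: "hser u v \<alpha> k ?zs ls = ?T ls"
      if ls: "ls \<in> interlacing bs" and "sorted_wrt (<) ls \<or> u = 1 \<and> v = 1" for ls
    proof (rule Suc.hyps(1))
      have "length ls = n" using ls Suc.hyps(2) by (auto simp: interlacing_def)
      then show "n = length ls" "ls \<noteq> []" "length ?zs = length ls" "distinct ?zs" using False by auto
      show "sorted ls" using ls by (rule interlacing_sorted)
      have "bs ! 0 \<le> ls ! 0" using ls \<open>ls \<noteq> []\<close> by (auto simp: interlacing_def)
      then show "\<alpha> \<le> ls ! 0" using Suc.prems(5) by linarith
    qed (use that in auto)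
    have row: "row_coeff u v bs ls * hser u v \<alpha> k ?zs ls =
        (if sorted_wrt (<) ls then row_weight u v bs ls * ?T ls else 0)"
      if ls: "ls \<in> interlacing bs" for ls
    proof (cases "sorted_wrt (<) bs")
      case True
      \<comment> \<open>The induction hypothesis covers the strict rows; all others have coefficient
        zero.\<close>
      then show ?thesis using row_coeff_strict[OF True ls, of u v] IH[OF ls] by auto
    next
      case weak: False
      then have uv: "u = 1" "v = 1" using Suc.prems(6) by auto
      show ?thesis
      \<comment> \<open>A row with three equal entries may have a wrong coefficient, but it is
        multiplied by an empty triangle sum.\<close>
      proof (cases "\<exists>i. Suc (Suc i) < length ls \<and> ls ! i = ls ! Suc (Suc i)")
        case True
        then obtain i where i: "Suc (Suc i) < length ls" "ls ! i = ls ! Suc (Suc i)" by blast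
        then have "\<not> sorted_wrt (<) ls" using sorted_wrt_nth_less[of "(<)" ls i "Suc (Suc i)"] by auto
        moreover have "?T ls = 0" using triangles_above_eq_empty[OF i] by (simp add: triangle_sum_def)
        ultimately show ?thesis using IH[OF ls] uv by simp
      next
        case False
        have "ls ! i < ls ! Suc (Suc i)" if "Suc (Suc i) < length ls" for i
        proof -
          have "ls ! i \<le> ls ! Suc (Suc i)"
            using interlacing_sorted[OF ls] that by (intro sorted_nth_mono) auto
          then show ?thesis using False that by (auto simp: less_le)
        qed
        then have "row_coeff 1 1 bs ls = (if sorted_wrt (<) ls then 1 else (0 :: 'a))"
          by (rule row_coeff_one[OF ls])
        then show ?thesis using IH[OF ls] uv by (simp add: row_weight_def)
      qed
    qed
    have "hser u v \<alpha> k xs bs = (\<Sum>ls\<in>interlacing bs. row_coeff u v bs ls * hser u v \<alpha> k ?zs ls)"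
      using Suc.prems Suc.hyps(2) False by (intro hser_row_sum) auto
    also have "\<dots> = (\<Sum>ls\<in>interlacing bs. if sorted_wrt (<) ls then row_weight u v bs ls * ?T ls else 0)"
      by (intro sum.cong refl row)
    also have "\<dots> = (\<Sum>ls\<in>{ls \<in> interlacing bs. sorted_wrt (<) ls}. row_weight u v bs ls * ?T ls)"
      by (rule sum.inter_filter[symmetric]) (rule finite_interlacing)
    also have "\<dots> = ?T bs"
      using Suc.hyps(2) False by (intro triangle_sum_rows[symmetric, of _ n]) auto
    finally show ?thesis .
  qed
qed simp

section \<open>Binomial inversion in the top entry\<close>

text \<open>Since (k choose c)(d choose k) = (d choose c)(d - c choose k - c), what remains is an
  alternating sum over a row of Pascal's triangle. The range ends at \<open>N\<close> rather than
  \<open>d\<close> so that one range serves all top entries.\<close>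

lemma binomial_inversion:
  assumes "d \<le> N"
  shows "(\<Sum>k=0..N. (- 1) ^ (c + k) * of_nat (k choose c) * of_nat (d choose k)) =
    (if d = c then 1 else 0 :: 'a::comm_ring_1)"
proof (cases "c \<le> d")
  case True
  have "(\<Sum>k=0..N. (- 1) ^ (c + k) * of_nat (k choose c) * of_nat (d choose k)) =
      (\<Sum>k\<in>{c..d}. (- 1) ^ (c + k) * of_nat (k choose c) * of_nat (d choose k) :: 'a)"
    by (rule sum.mono_neutral_right) (use assms in \<open>auto simp: not_le binomial_eq_0\<close>)
  also have "\<dots> = (\<Sum>i\<le>d - c. (- 1) ^ (c + (c + i)) * of_nat (c + i choose c) * of_nat (d choose (c + i)))"
    by (rule sum.reindex_bij_witness[of _ "\<lambda>i. c + i" "\<lambda>k. k - c"]) (use True in auto)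
  also have "\<dots> = (\<Sum>i\<le>d - c. of_nat (d choose c) * ((- 1) ^ i * of_nat (d - c choose i)))"
  proof (rule sum.cong)
    fix i assume "i \<in> {..d - c}"
    then have "(d choose (c + i)) * (c + i choose c) = (d choose c) * (d - c choose i)"
      using choose_mult[of c "c + i" d] True by auto
    then have "of_nat (c + i choose c) * of_nat (d choose (c + i)) =
        (of_nat (d choose c) * of_nat (d - c choose i) :: 'a)"
      by (simp only: of_nat_mult[symmetric] mult.commute)
    then show "(- 1) ^ (c + (c + i)) * of_nat (c + i choose c) * of_nat (d choose (c + i)) =
        (of_nat (d choose c) * ((- 1) ^ i * of_nat (d - c choose i)) :: 'a)"
      by (simp add: power_add mult.left_commute mult.assoc power2_eq_square[symmetric] flip: power_mult_distrib)
  qed simp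
  also have "\<dots> = (if d = c then 1 else 0)"
    using choose_alternating_sum[of "d - c", where 'a = 'a] True
    by (auto simp: sum_distrib_left[symmetric])
  finally show ?thesis .
next
  case False
  then have "of_nat (k choose c) * of_nat (d choose k) = (0 :: 'a)" for k
    by (cases "k < c") (simp_all add: binomial_eq_0)
  then show ?thesis using False by (auto simp: mult.assoc)
qed

section \<open>Rewriting both sides of the identity over lists\<close>

lemma prod_list_mult:
  "(\<Prod>x\<leftarrow>xs. f x * g x) = (\<Prod>x\<leftarrow>xs. f x) * (\<Prod>x\<leftarrow>xs. g x :: 'b::comm_monoid_mult)"
  by (induction xs) (simp_all add: mult_ac)

lemma pair_prod_mult: "pair_prod (\<lambda>x y. f x y * g x y) xs = pair_prod f xs * pair_prod g xs"
  by (induction xs) (simp_all add: prod_list_mult mult_ac)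

lemma prod_pairs_eq_pair_prod:
  fixes xs :: "nat list"
  assumes "sorted_wrt (<) xs"
  shows "(\<Prod>(i, j)\<in>{(i, j). i \<in> set xs \<and> j \<in> set xs \<and> i < j}. f i j) = pair_prod f xs"
  using assms
proof (induction xs)
  case (Cons x xs)
  let ?S = "{(i, j). i \<in> set xs \<and> j \<in> set xs \<and> i < j}"
  have "{(i, j). i \<in> set (x # xs) \<and> j \<in> set (x # xs) \<and> i < j} = Pair x ` set xs \<union> ?S"
    using Cons.prems by auto
  moreover have "Pair x ` set xs \<inter> ?S = {}" using Cons.prems by auto
  moreover have "finite ?S" by (rule finite_subset[of _ "set xs \<times> set xs"]) auto
  ultimately have "(\<Prod>(i, j)\<in>{(i, j). i \<in> set (x # xs) \<and> j \<in> set (x # xs) \<and> i < j}. f i j) =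
      (\<Prod>(i, j)\<in>Pair x ` set xs. f i j) * (\<Prod>(i, j)\<in>?S. f i j)"
    by (simp add: prod.union_disjoint)
  moreover have "(\<Prod>(i, j)\<in>Pair x ` set xs. f i j) = (\<Prod>y\<leftarrow>xs. f x y)"
    using Cons.prems by (simp add: prod.reindex inj_on_def prod.distinct_set_conv_list strict_sorted_iff)
  ultimately show ?case using Cons by simp
qed simp

text \<open>A difference of inverses satisfies 1/y - 1/x = (x - y)/(x y). Each variable lies in
  \<open>length xs - 1\<close> pairs, which gives its power, and the orientation of the differences
  is reversed.\<close>

lemma vand_inverse_vars:
  fixes xs :: "nat list"
  shows "vand (map (\<lambda>x. ml_var_pow x (- 1)) xs) =
    (\<Prod>x\<leftarrow>xs. ml_var_pow x (- int (length xs) + 1)) * pair_prod (\<lambda>x y. ml_var x - ml_var y) xs"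
proof (induction xs)
  case (Cons x xs)
  let ?W = "\<lambda>x. ml_var_pow x (- 1) :: 'a mlaurent"
  have W: "?W y - ?W x = ?W x * ?W y * (ml_var x - ml_var y)" for y
  proof -
    have "?W x * ?W y * (ml_var x - ml_var y) = (?W x * ml_var x) * ?W y - ?W x * (?W y * ml_var y)"
      by (simp only: right_diff_distrib mult_ac)
    then show ?thesis by (simp add: ml_var_inverse)
  qed
  have pow: "(\<Prod>y\<leftarrow>ys. ?W x) = ml_var_pow x (- int (length ys))" for ys :: "nat list"
    by (induction ys) (simp_all add: ml_var_pow_mult)
  have shift: "(\<Prod>y\<leftarrow>ys. ?W y) * (\<Prod>y\<leftarrow>ys. ml_var_pow y k) = (\<Prod>y\<leftarrow>ys. ml_var_pow y (k - 1))" for ys k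
    by (simp add: prod_list_mult[symmetric] ml_var_pow_mult)
  have "(\<Prod>y\<leftarrow>xs. ?W y - ?W x) = ml_var_pow x (- int (length xs)) * (\<Prod>y\<leftarrow>xs. ?W y) *
      (\<Prod>y\<leftarrow>xs. ml_var x - ml_var y)"
    by (simp only: W prod_list_mult pow)
  then have "vand (map ?W (x # xs)) = ml_var_pow x (- int (length xs)) *
      ((\<Prod>y\<leftarrow>xs. ?W y) * (\<Prod>y\<leftarrow>xs. ml_var_pow y (- int (length xs) + 1))) *
      ((\<Prod>y\<leftarrow>xs. ml_var x - ml_var y) * pair_prod (\<lambda>x y. ml_var x - ml_var y) xs)"
    using Cons by (simp add: o_def mult_ac)
  then show ?case by (simp add: shift)
qed simp

lemma prod_atLeastAtMost_eq_prod_list: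
  fixes f :: "nat \<Rightarrow> 'b::comm_monoid_mult"
  shows "(\<Prod>i=1..n. f i) = (\<Prod>i\<leftarrow>[1..<Suc n]. f i)"
  using prod.distinct_set_conv_list[of "[1..<Suc n]" f]
  by (simp add: atLeastLessThanSuc_atLeastAtMost del: upt_Suc)

text \<open>The monomials and differences of \<open>mt_series\<close> combine to \<open>vand\<close>
  in the inverse variables, and its two families of powers of 1 + x combine to
  \<open>yprod\<close>.\<close>

lemma mt_series_constant_term:
  fixes u v :: "'a::{idom, ring_char_0}"
  shows "ml_constant_term (mt_series n b \<alpha> \<beta> a u v) =
    (\<Sum>k=0..nat (\<beta> - \<alpha>). (if even (a + \<alpha> + int k) then 1 else - 1) * of_nat (k choose nat (a - \<alpha>)) *
       hser u v \<alpha> k [1..<Suc n] (map b [1..<Suc n]))"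
proof -
  let ?xs = "[1..<Suc n]" and ?bs = "map b [1..<Suc n]"
  let ?s = "\<lambda>k. (if even (a + \<alpha> + int k) then 1 else - 1) * of_nat (k choose nat (a - \<alpha>)) :: 'a"
  have pairs: "{(i, j). 1 \<le> i \<and> i < j \<and> j \<le> n} = {(i, j). i \<in> set ?xs \<and> j \<in> set ?xs \<and> i < j}"
    by auto
  have y: "yprod \<alpha> ?xs ?bs = (\<Prod>i\<leftarrow>?xs. ml_one_plus_var_pow i (b i)) * (\<Prod>i\<leftarrow>?xs. ml_one_plus_var_pow i (- \<alpha>))"
    by (simp add: yprod_def zip_map2 zip_same_conv_map o_def ypow_def prod_list_mult[symmetric]
        ml_one_plus_var_pow_add[symmetric] del: upt_Suc)
  have "(\<Prod>(i, j)\<in>{(i, j). 1 \<le> i \<and> i < j \<and> j \<le> n}.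
        (ml_var i - ml_var j) *
        (1 + (1 - ml_const v) * ml_var i + ml_const u * (ml_var j + ml_var i * ml_var j))) =
      pair_prod (\<lambda>i j. (ml_var i - ml_var j) * tfac u v i j) ?xs"
    unfolding pairs tfac_def by (rule prod_pairs_eq_pair_prod) (rule sorted_wrt_upt)
  moreover have "(if even (a + \<alpha> + int k) then 1 else - 1 :: 'a mlaurent) * of_nat (k choose nat (a - \<alpha>)) =
      ml_const (?s k)" for k
    by (simp add: of_nat_eq_ml_const ml_const_uminus)
  ultimately have "mt_series n b \<alpha> \<beta> a u v =
      (\<Sum>k=0..nat (\<beta> - \<alpha>). ml_const (?s k) * (qser u v k ?xs * yprod \<alpha> ?xs ?bs))"
    unfolding mt_series_def prod_atLeastAtMost_eq_prod_list qser_def y hsym_def vand_inverse_vars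
      pair_prod_mult prod_list_mult sum_distrib_left
    by (simp only: length_upt diff_Suc_1 mult_ac)
  then show ?thesis by (simp add: ml_constant_term_simps hser_def del: upt_Suc)
qed

lemma mt_gen_fun_eq_triangle_sum:
  assumes "1 \<le> n"
  shows "mt_gen_fun n b a u v = triangle_sum u v (\<lambda>c. if c = a then 1 else 0) (map b [1..<Suc n])"
proof -
  let ?bs = "map b [1..<Suc n]"
  have len: "length ?bs = n" by simp
  have "(\<forall>i<n. m (n, Suc i) = ?bs ! i) \<longleftrightarrow> (\<forall>j\<in>{1..n}. m (n, j) = b j)" for m
  proof (intro iffI ballI)
    fix j assume all: "\<forall>i<n. m (n, Suc i) = ?bs ! i" and j: "j \<in> {1..n}"
    then obtain i where "j = Suc i" by (cases j) auto
    then show "m (n, j) = b j" using all j by (simp del: upt_Suc)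
  qed (auto simp del: upt_Suc)
  then have "monotone_triangles_with n b a = {m \<in> triangles_above ?bs. m (1, 1) = a}"
    unfolding monotone_triangles_with_def triangles_above_def len by blast
  then have "mt_gen_fun n b a u v = (\<Sum>m\<in>triangles_above ?bs. if m (1, 1) = a then
      u ^ mt_inv n m * v ^ mt_inv' n m else 0)"
    unfolding mt_gen_fun_def using finite_triangles_above[of ?bs] assms by (simp add: sum.inter_filter del: upt_Suc)
  also have "\<dots> = triangle_sum u v (\<lambda>c. if c = a then 1 else 0) ?bs"
    unfolding triangle_sum_def len by (intro sum.cong refl) simp
  finally show ?thesis .
qed

section \<open>Combining the row recursion with binomial inversion\<close>

lemma mt_gen_fun_eq_constant_term:
  fixes u v :: "'a::{idom, ring_char_0}"
  assumes n: "1 \<le> n" and a: "\<alpha> \<le> a" "a \<le> \<beta>" and b: "\<alpha> \<le> b 1" "b n \<le> \<beta>"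
    and mono: "strict_mono_on {1..n} b \<or> mono_on {1..n} b \<and> u = 1 \<and> v = 1"
  shows "mt_gen_fun n b a u v = ml_constant_term (mt_series n b \<alpha> \<beta> a u v)"
proof -
  let ?bs = "map b [1..<Suc n]" and ?N = "nat (\<beta> - \<alpha>)" and ?c = "nat (a - \<alpha>)"
  have len: "length ?bs = n" by simp
  have ne: "?bs \<noteq> []" using n len by (metis list.size(3) not_one_le_zero)
  have ends: "?bs ! 0 = b 1" "last ?bs = b n" using n by (simp_all add: last_map nth_append)
  have "mono_on {1..n} b" using mono strict_mono_on_imp_mono_on by blast
  then have sorted: "sorted ?bs"
    by (auto simp: sorted_wrt_map sorted_wrt_iff_nth_less monotone_on_def simp del: upt_Suc)
  have strict: "sorted_wrt (<) ?bs \<or> u = 1 \<and> v = 1"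
    using mono by (auto simp: sorted_wrt_map sorted_wrt_iff_nth_less monotone_on_def simp del: upt_Suc)
  have hser: "hser u v \<alpha> k [1..<Suc n] ?bs =
      triangle_sum u v (\<lambda>c. of_nat (nat (c - \<alpha>) choose k)) ?bs" for k
    using ne sorted strict b ends by (intro hser_eq_triangle_sum) (simp_all del: upt_Suc)
  \<comment> \<open>Replacing a + \<alpha> by a - \<alpha> keeps the parity and makes the exponent a
    natural number.\<close>
  have sign: "(if even (a + \<alpha> + int k) then 1 else - 1) = ((- 1) ^ (?c + k) :: 'a)" for k
  proof -
    have "even (a + \<alpha> + int k) \<longleftrightarrow> even (?c + k)" using a by (simp add: even_nat_iff)
    then show ?thesis by simp
  qed
  let ?w = "\<lambda>m. u ^ mt_inv n m * v ^ mt_inv' n m"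
  have "ml_constant_term (mt_series n b \<alpha> \<beta> a u v) =
      (\<Sum>k=0..?N. \<Sum>m\<in>triangles_above ?bs.
        ?w m * ((- 1) ^ (?c + k) * of_nat (k choose ?c) * of_nat (nat (m (1, 1) - \<alpha>) choose k)))"
    unfolding mt_series_constant_term hser sign triangle_sum_def len
    by (simp add: sum_distrib_left mult_ac)
  also have "\<dots> = (\<Sum>m\<in>triangles_above ?bs. ?w m *
      (\<Sum>k=0..?N. (- 1) ^ (?c + k) * of_nat (k choose ?c) * of_nat (nat (m (1, 1) - \<alpha>) choose k)))"
    by (subst sum.swap) (simp add: sum_distrib_left)
  also have "\<dots> = (\<Sum>m\<in>triangles_above ?bs. ?w m * (if m (1, 1) = a then 1 else 0))"
  proof (intro sum.cong refl)
    fix m assume "m \<in> triangles_above ?bs"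
    \<comment> \<open>The top entry lies between \<open>b 1\<close> and \<open>b n\<close>, hence
      between \<alpha> and \<beta>. So \<open>nat\<close> truncates nothing and the inversion
      applies with \<open>d \<le> N\<close>.\<close>
    then have top: "\<alpha> \<le> m (1, 1)" "m (1, 1) \<le> \<beta>"
      using triangle_top_bounds[of m ?bs] ne ends b by auto
    then have "nat (m (1, 1) - \<alpha>) \<le> ?N" "nat (m (1, 1) - \<alpha>) = ?c \<longleftrightarrow> m (1, 1) = a"
      using a by auto
    then show "?w m * (\<Sum>k=0..?N. (- 1) ^ (?c + k) * of_nat (k choose ?c) *
        of_nat (nat (m (1, 1) - \<alpha>) choose k)) = ?w m * (if m (1, 1) = a then 1 else 0)"
      by (simp add: binomial_inversion)
  qed
  also have "\<dots> = mt_gen_fun n b a u v"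
    unfolding mt_gen_fun_eq_triangle_sum[OF n] triangle_sum_def len ..
  finally show ?thesis by simp
qed

theorem theorem2p3:
  fixes n :: nat and b :: "nat \<Rightarrow> int" and \<alpha> \<beta> a :: int
  assumes "1 \<le> n" and "\<alpha> \<le> a" and "a \<le> \<beta>" and "\<alpha> \<le> b 1" and "b n \<le> \<beta>"
  shows "(strict_mono_on {1..n} b \<longrightarrow>
            mt_gen_fun n b a indet_u indet_v =
              ml_constant_term (mt_series n b \<alpha> \<beta> a indet_u indet_v)) \<and>
         (mono_on {1..n} b \<longrightarrow>
            mt_gen_fun n b a (1 :: int) 1 =
              ml_constant_term (mt_series n b \<alpha> \<beta> a 1 1))"
  using assms by (auto intro!: mt_gen_fun_eq_constant_term)

end
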